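(* Let $\mathcal G$ be a graph on $n$ vertices and let $k$ be the number of vertices of its skeleton $\mathcal G^\circ$. Then the skeleton of the quantum graph $(\mathcal S_{\mathcal G},D_n)$ is the quantum graph $(\mathcal S_{\mathcal G^\circ},D_k)$.
   Context: All graphs are finite, simple and undirected, and the vertex set of a graph on $n$ vertices is identified with $\{1,\dots,n\}$. Write $x\simeq_{\mathcal G}y$ if $x=y$ or $x$ is adjacent to $y$. $D_n\subseteq M_n$ is the algebra of diagonal matrices and $\mathcal S_{\mathcal G}=\operatorname{span}\{\varepsilon_{xy}: x\simeq_{\mathcal G}y\}\subseteq M_n$ is the graph operator system, with $\varepsilon_{xy}$ the matrix units. Skeleton of a graph: vertices $x,y$ are true twins if $\{z: x\simeq_{\mathcal G}z\}=\{z: y\simeq_{\mathcal G}z\}$. The skeleton $\mathcal G^\circ$ is the graph whose vertices are the true-twin equivalence classes $[x]$, with distinct classes $[x],[y]$ adjacent whenever $x$ is adjacent to $y$ in $\mathcal G$. Quantum graph: $(\mathcal S,\mathcal A)$ acting on a finite-dimensional Hilbert space $H$, where $\mathcal A=\mathcal A''\subseteq\mathcal B(H)$ is a von Neumann algebra and $\mathcal S\subseteq\mathcal B(H)$ is an operator system (selfadjoint subspace containing $I_H$) with $\mathcal A'\mathcal S\mathcal A'\subseteq\mathcal S$. It acts irreducibly if there is no non-trivial subspace $L\subseteq H$ reducing $\mathcal S$ such that $s\mapsto s|_L$ is completely isometric; $(\mathcal S_{\mathcal G},D_n)$ acts irreducibly on $\mathbb C^n$. Skeleton of an irreducibly acting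 quantum graph $(\mathcal S,\mathcal A)$ on $H$: let $\mathcal A_{\mathcal S}=\{a\in\mathrm C^*(\mathcal S): a\mathcal S\subseteq\mathcal S,\ a^*\mathcal S\subseteq\mathcal S\}\subseteq\mathcal B(H)$ be the multiplier algebra. Up to unitary equivalence, $H=\bigoplus_{i=1}^k(\mathbb C^{\alpha_i}\otimes\mathbb C^{n_i})$ and $\mathcal A_{\mathcal S}=\bigoplus_{i=1}^k(M_{\alpha_i}\otimes I_{n_i})$. Let $p_i$ be the projection onto $H_i=\mathbb C^{\alpha_i}\otimes\mathbb C^{n_i}$, $\mathcal S_{ij}=p_i\mathcal Sp_j\subseteq\mathcal B(H_j,H_i)\cong M_{\alpha_i,\alpha_j}\otimes M_{n_i,n_j}$, and $\mathcal R_{ij}=L_{\varepsilon_{11}^{(j,i)}}(\mathcal S_{ij})\subseteq M_{n_i,n_j}$, where $L_{\varepsilon_{11}^{(j,i)}}(a\otimes b)=\operatorname{Tr}(\varepsilon_{11}^{(j,i)}a)\,b$ and $\varepsilon_{11}^{(j,i)}$ is the $(1,1)$ matrix unit of $M_{\alpha_j,\alpha_i}$. With $L=\bigoplus_i\mathbb C^{n_i}$, the skeleton is $(\mathcal R,\mathcal C)$ with $\mathcal C=\bigoplus_iM_{n_i}\subseteq\mathcal B(L)$ and $\mathcal R=\bigoplus_{i,j}\mathcal R_{ij}\subseteq\mathcal B(L)$ (block operator matrices with $(i,j)$ entry in $\mathcal R_{ij}$). In the claim, the blocks are indexed by the true-twin classes, i.e. by the vertices of $\mathcal G^\circ$ identified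 with $\{1,\dots,k\}$, and $\mathcal B(L)$ is identified with $M_k$. *)

theory Defs
  imports
    Complex_Main
    "Graph_Theory.Pair_Digraph"
    "Jordan_Normal_Form.VS_Connect"
    "Jordan_Normal_Form.Schur_Decomposition"
begin

text \<open>
  A finite-dimensional Hilbert space is taken to be \<open>\<complex>\<^sup>n\<close>, and \<open>M\<^sub>n\<close> is
  \<open>carrier_mat n n\<close>.  All indices start at 0, so \<open>{0..<n}\<close> plays the role of
  \<open>{1,\<dots>,n}\<close>.  A finite simple undirected graph is a \<open>pair_graph\<close>: finite, symmetric,
  without loops or parallel arcs.
\<close>


section \<open>Graphs and their skeletons\<close>

definition adj_eq :: "'v pair_pre_digraph \<Rightarrow> 'v \<Rightarrow> 'v \<Rightarrow> bool" where
  "adj_eq G x y \<longleftrightarrow> x = y \<or> (x, y) \<in> parcs G"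

definition closed_nbhd :: "'v pair_pre_digraph \<Rightarrow> 'v \<Rightarrow> 'v set" where
  "closed_nbhd G x = {z \<in> pverts G. adj_eq G x z}"

definition twin_class :: "'v pair_pre_digraph \<Rightarrow> 'v \<Rightarrow> 'v set" where
  "twin_class G x = {y \<in> pverts G. closed_nbhd G y = closed_nbhd G x}"

definition graph_skeleton :: "'v pair_pre_digraph \<Rightarrow> 'v set pair_pre_digraph" where
  "graph_skeleton G =
     \<lparr> pverts = twin_class G ` pverts G,
       parcs = {(twin_class G x, twin_class G y) | x y.
                  (x, y) \<in> parcs G \<and> twin_class G x \<noteq> twin_class G y} \<rparr>"

text \<open>The identification of the vertices of a graph with \<open>0, \<dots>, k - 1\<close> along a
  bijection \<open>v\<close> from \<open>{0..<k}\<close> to the vertex set.\<close>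

definition enumerates :: "(nat \<Rightarrow> 'v) \<Rightarrow> nat \<Rightarrow> 'v pair_pre_digraph \<Rightarrow> bool" where
  "enumerates v k G \<longleftrightarrow> bij_betw v {0..<k} (pverts G)"

definition relabel :: "(nat \<Rightarrow> 'v) \<Rightarrow> nat \<Rightarrow> 'v pair_pre_digraph \<Rightarrow> nat pair_pre_digraph" where
  "relabel v k G =
     \<lparr> pverts = {0..<k}, parcs = {(i, j). i < k \<and> j < k \<and> (v i, v j) \<in> parcs G} \<rparr>"


section \<open>Operators on \<open>\<complex>\<^sup>n\<close>\<close>

definition mat_unit :: "nat \<Rightarrow> nat \<Rightarrow> nat \<Rightarrow> nat \<Rightarrow> complex mat" where
  "mat_unit nr nc x y = mat nr nc (\<lambda>(i, j). if i = x \<and> j = y then 1 else 0)"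

definition diagonal_algebra :: "nat \<Rightarrow> complex mat set" where
  "diagonal_algebra n = {a \<in> carrier_mat n n. diagonal_mat a}"

definition graph_system :: "nat \<Rightarrow> nat pair_pre_digraph \<Rightarrow> complex mat set" where
  "graph_system n G =
     LinearCombinations.module.span class_ring (module_mat TYPE(complex) n n)
       {mat_unit n n x y | x y. x \<in> pverts G \<and> y \<in> pverts G \<and> adj_eq G x y}"

definition unitary_mat :: "nat \<Rightarrow> complex mat \<Rightarrow> bool" where
  "unitary_mat n U \<longleftrightarrow> U \<in> carrier_mat n n \<and>
     U * mat_adjoint U = 1\<^sub>m n \<and> mat_adjoint U * U = 1\<^sub>m n"

definition mat_commutant :: "nat \<Rightarrow> complex mat set \<Rightarrow> complex mat set" where
  "mat_commutant n A = {b \<in> carrier_mat n n. \<forall>a\<in>A. a * b = b * a}"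

definition von_neumann_algebra :: "nat \<Rightarrow> complex mat set \<Rightarrow> bool" where
  "von_neumann_algebra n A \<longleftrightarrow> A \<subseteq> carrier_mat n n \<and> (\<forall>a\<in>A. mat_adjoint a \<in> A) \<and>
     mat_commutant n (mat_commutant n A) = A"

definition operator_system :: "nat \<Rightarrow> complex mat set \<Rightarrow> bool" where
  "operator_system n S \<longleftrightarrow>
     VectorSpace.subspace class_ring S (module_mat TYPE(complex) n n) \<and>
     (\<forall>s\<in>S. mat_adjoint s \<in> S) \<and> 1\<^sub>m n \<in> S"

definition quantum_graph :: "nat \<Rightarrow> complex mat set \<times> complex mat set \<Rightarrow> bool" where
  "quantum_graph n = (\<lambda>(S, A). von_neumann_algebra n A \<and> operator_system n S \<and>
     (\<forall>a\<in>mat_commutant n A. \<forall>s\<in>S. \<forall>b\<in>mat_commutant n A. a * s * b \<in> S))"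

text \<open>In \<open>M\<^sub>n\<close> every *-subalgebra is norm closed, so no closure is needed here.\<close>

definition star_subalgebra :: "nat \<Rightarrow> complex mat set \<Rightarrow> bool" where
  "star_subalgebra n B \<longleftrightarrow>
     VectorSpace.subspace class_ring B (module_mat TYPE(complex) n n) \<and>
     (\<forall>a\<in>B. \<forall>b\<in>B. a * b \<in> B) \<and> (\<forall>a\<in>B. mat_adjoint a \<in> B)"

definition Cstar_generated :: "nat \<Rightarrow> complex mat set \<Rightarrow> complex mat set" where
  "Cstar_generated n S = \<Inter>{B. star_subalgebra n B \<and> S \<subseteq> B}"

definition multiplier_algebra :: "nat \<Rightarrow> complex mat set \<Rightarrow> complex mat set" where
  "multiplier_algebra n S =
     {a \<in> Cstar_generated n S. (\<forall>s\<in>S. a * s \<in> S) \<and> (\<forall>s\<in>S. mat_adjoint a * s \<in> S)}"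


section \<open>Block decompositions\<close>

text \<open>For a direct sum \<open>\<Oplus>\<^sub>i \<complex>\<^bsup>d i\<^esup>\<close> with the summands listed consecutively,
  summand \<open>i\<close> occupies the coordinates from \<open>block_start d i\<close> up to, but excluding,
  \<open>block_start d (Suc i)\<close>.\<close>

definition block_start :: "(nat \<Rightarrow> nat) \<Rightarrow> nat \<Rightarrow> nat" where
  "block_start d i = (\<Sum>l<i. d l)"

definition mat_block :: "(nat \<Rightarrow> nat) \<Rightarrow> nat \<Rightarrow> nat \<Rightarrow> complex mat \<Rightarrow> complex mat" where
  "mat_block d i j X =
     mat (d i) (d j) (\<lambda>(r, c). X $$ (block_start d i + r, block_start d j + c))"

definition vec_block :: "(nat \<Rightarrow> nat) \<Rightarrow> nat \<Rightarrow> complex vec \<Rightarrow> complex vec" where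
  "vec_block d i w = vec (d i) (\<lambda>r. w $ (block_start d i + r))"

definition block_proj :: "nat \<Rightarrow> (nat \<Rightarrow> nat) \<Rightarrow> nat \<Rightarrow> complex mat" where
  "block_proj n d i = mat n n (\<lambda>(r, c).
     if r = c \<and> block_start d i \<le> r \<and> r < block_start d (Suc i) then 1 else 0)"


section \<open>Irreducibility\<close>

definition vec_norm2 :: "complex vec \<Rightarrow> real" where
  "vec_norm2 w = sqrt (Re (w \<bullet>c w))"

definition norm_on :: "complex vec set \<Rightarrow> complex mat \<Rightarrow> real" where
  "norm_on W T = Sup {vec_norm2 (T *\<^sub>v w) | w. w \<in> W \<and> vec_norm2 w \<le> 1}"

text \<open>\<open>L \<oplus> \<dots> \<oplus> L\<close> (\<open>m\<close> summands), as a subspace of \<open>\<complex>\<^bsup>m n\<^esup>\<close>.\<close>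

definition amplify :: "nat \<Rightarrow> nat \<Rightarrow> complex vec set \<Rightarrow> complex vec set" where
  "amplify m n L = {w \<in> carrier_vec (m * n). \<forall>p<m. vec_block (\<lambda>_. n) p w \<in> L}"

definition reduces :: "complex vec set \<Rightarrow> complex mat set \<Rightarrow> bool" where
  "reduces L S \<longleftrightarrow> (\<forall>s\<in>S. \<forall>w\<in>L. s *\<^sub>v w \<in> L \<and> mat_adjoint s *\<^sub>v w \<in> L)"

text \<open>The matrices over \<open>S\<close> of size \<open>m\<close> are the \<open>T\<close> in \<open>M\<^sub>m\<^sub>n\<close> all of whose \<open>n\<close>-by-\<open>n\<close>
  blocks lie in \<open>S\<close>; restricting all the entries to \<open>L\<close> restricts \<open>T\<close> to \<open>L \<oplus> \<dots> \<oplus> L\<close>.\<close>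

definition restriction_completely_isometric ::
    "nat \<Rightarrow> complex mat set \<Rightarrow> complex vec set \<Rightarrow> bool" where
  "restriction_completely_isometric n S L \<longleftrightarrow>
     (\<forall>m. \<forall>T\<in>carrier_mat (m * n) (m * n).
        (\<forall>p<m. \<forall>q<m. mat_block (\<lambda>_. n) p q T \<in> S) \<longrightarrow>
        norm_on (amplify m n L) T = norm_on (carrier_vec (m * n)) T)"

definition acts_irreducibly :: "nat \<Rightarrow> complex mat set \<Rightarrow> bool" where
  "acts_irreducibly n S \<longleftrightarrow>
     \<not> (\<exists>L. VectorSpace.subspace class_ring L (module_vec TYPE(complex) n) \<and>
            L \<noteq> {0\<^sub>v n} \<and> L \<noteq> carrier_vec n \<and> reduces L S \<and>
            restriction_completely_isometric n S L)"


section \<open>The skeleton of a quantum graph\<close>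

definition kron :: "complex mat \<Rightarrow> complex mat \<Rightarrow> complex mat" where
  "kron a b = mat (dim_row a * dim_row b) (dim_col a * dim_col b)
     (\<lambda>(r, c). a $$ (r div dim_row b, c div dim_col b) * b $$ (r mod dim_row b, c mod dim_col b))"

text \<open>The slice map \<open>L\<^sub>\<omega>\<close> from \<open>M\<^sub>p\<^sub>,\<^sub>q \<otimes> M\<^sub>r\<^sub>,\<^sub>s\<close> to \<open>M\<^sub>r\<^sub>,\<^sub>s\<close> for \<open>\<omega>\<close> in \<open>M\<^sub>q\<^sub>,\<^sub>p\<close>; lemma
  \<open>slice_kron\<close> gives its value on elementary tensors.\<close>

definition slice :: "nat \<Rightarrow> nat \<Rightarrow> complex mat \<Rightarrow> complex mat \<Rightarrow> complex mat" where
  "slice r s \<omega> X = mat r s (\<lambda>(b, b').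
     \<Sum>a<dim_col \<omega>. \<Sum>a'<dim_row \<omega>. \<omega> $$ (a', a) * X $$ (a * r + b, a' * s + b'))"

lemma slice_kron:
  assumes \<omega>: "\<omega> \<in> carrier_mat q p" and a: "a \<in> carrier_mat p q" and b: "b \<in> carrier_mat r s"
  shows "slice r s \<omega> (kron a b) = (\<Sum>i<q. (\<omega> * a) $$ (i, i)) \<cdot>\<^sub>m b"
proof (rule eq_matI)
  fix x y assume "x < dim_row ((\<Sum>i<q. (\<omega> * a) $$ (i, i)) \<cdot>\<^sub>m b)"
    and "y < dim_col ((\<Sum>i<q. (\<omega> * a) $$ (i, i)) \<cdot>\<^sub>m b)"
  then have x: "x < r" and y: "y < s" using b by auto
  have entry: "kron a b $$ (i * r + x, j * s + y) = a $$ (i, j) * b $$ (x, y)"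
    if "i < p" "j < q" for i j
  proof -
    have bound: "i * r + x < p * r" "j * s + y < q * s"
      using that x y
      by (metis add.commute div_less_iff_less_mult div_mult_self3 gr_implies_not0
          add_0_right div_less gr0I)+
    show ?thesis using a b x y bound unfolding kron_def by simp
  qed
  have "slice r s \<omega> (kron a b) $$ (x, y)
        = (\<Sum>i<p. \<Sum>j<q. \<omega> $$ (j, i) * a $$ (i, j) * b $$ (x, y))"
    using \<omega> x y unfolding slice_def by (simp add: entry mult.assoc)
  also have "\<dots> = (\<Sum>j<q. \<Sum>i<p. \<omega> $$ (j, i) * a $$ (i, j)) * b $$ (x, y)"
    by (subst sum.swap) (simp add: sum_distrib_right)
  also have "(\<Sum>j<q. \<Sum>i<p. \<omega> $$ (j, i) * a $$ (i, j)) = (\<Sum>j<q. (\<omega> * a) $$ (j, j))"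
    using \<omega> a by (intro sum.cong) (auto simp: scalar_prod_def lessThan_atLeast0)
  finally show "slice r s \<omega> (kron a b) $$ (x, y)
      = ((\<Sum>i<q. (\<omega> * a) $$ (i, i)) \<cdot>\<^sub>m b) $$ (x, y)"
    using b x y by simp
qed (use b in \<open>auto simp: slice_def\<close>)

text \<open>
  A decomposition \<open>(k, \<alpha>, m, U)\<close> consists of a unitary \<open>U\<close> from \<open>\<complex>\<^sup>n\<close> onto
  \<open>\<Oplus>\<^sub>i (\<complex>\<^bsup>\<alpha> i\<^esup> \<otimes> \<complex>\<^bsup>m i\<^esup>)\<close> (\<open>k\<close> summands) which carries the multiplier algebra onto
  \<open>\<Oplus>\<^sub>i (M\<^bsub>\<alpha> i\<^esub> \<otimes> I\<^bsub>m i\<^esub>)\<close>.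
\<close>

type_synonym decomposition = "nat \<times> (nat \<Rightarrow> nat) \<times> (nat \<Rightarrow> nat) \<times> complex mat"

definition multiplier_decomposition ::
    "nat \<Rightarrow> complex mat set \<Rightarrow> decomposition \<Rightarrow> bool" where
  "multiplier_decomposition n S = (\<lambda>(k, \<alpha>, m, U).
     (\<forall>i<k. 0 < \<alpha> i \<and> 0 < m i) \<and> (\<Sum>i<k. \<alpha> i * m i) = n \<and> unitary_mat n U \<and>
     {U * a * mat_adjoint U | a. a \<in> multiplier_algebra n S} =
     {diag_block_mat (map (\<lambda>i. kron (c i) (1\<^sub>m (m i))) [0..<k]) | c.
        \<forall>i<k. c i \<in> carrier_mat (\<alpha> i) (\<alpha> i)})"

text \<open>\<open>p\<^sub>i S p\<^sub>j\<close>, regarded as a space of operators from the \<open>j\<close>-th to the \<open>i\<close>-th summand.\<close>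

definition S_block ::
    "complex mat set \<Rightarrow> decomposition \<Rightarrow> nat \<Rightarrow> nat \<Rightarrow> complex mat set" where
  "S_block S = (\<lambda>(k, \<alpha>, m, U) i j.
     {mat_block (\<lambda>l. \<alpha> l * m l) i j (U * s * mat_adjoint U) | s. s \<in> S})"

definition R_block ::
    "complex mat set \<Rightarrow> decomposition \<Rightarrow> nat \<Rightarrow> nat \<Rightarrow> complex mat set" where
  "R_block S = (\<lambda>(k, \<alpha>, m, U) i j.
     slice (m i) (m j) (mat_unit (\<alpha> j) (\<alpha> i) 0 0) ` S_block S (k, \<alpha>, m, U) i j)"

text \<open>The triple \<open>(dim L, R, C)\<close>.\<close>

definition skeleton_wrt ::
    "complex mat set \<Rightarrow> decomposition \<Rightarrow> nat \<times> complex mat set \<times> complex mat set" where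
  "skeleton_wrt S = (\<lambda>(k, \<alpha>, m, U).
     let N = (\<Sum>i<k. m i) in
     (N,
      {X \<in> carrier_mat N N. \<forall>i<k. \<forall>j<k. mat_block m i j X \<in> R_block S (k, \<alpha>, m, U) i j},
      {diag_block_mat (map c [0..<k]) | c. \<forall>i<k. c i \<in> carrier_mat (m i) (m i)}))"

definition has_skeleton ::
    "nat \<Rightarrow> complex mat set \<times> complex mat set \<Rightarrow> decomposition \<Rightarrow>
     nat \<times> complex mat set \<times> complex mat set \<Rightarrow> bool" where
  "has_skeleton n = (\<lambda>(S, A) D K.
     quantum_graph n (S, A) \<and> acts_irreducibly n S \<and>
     multiplier_decomposition n S D \<and> K = skeleton_wrt S D)"

text \<open>The summands are indexed by the sets \<open>v 0, \<dots>, v (k - 1)\<close> of basis vectors of \<open>\<complex>\<^sup>n\<close>: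
  the \<open>i\<close>-th summand is the span of the basis vectors in \<open>v i\<close>.\<close>

definition blocks_indexed_by :: "nat \<Rightarrow> decomposition \<Rightarrow> (nat \<Rightarrow> nat set) \<Rightarrow> bool" where
  "blocks_indexed_by n = (\<lambda>(k, \<alpha>, m, U) v.
     \<forall>i<k. mat_adjoint U * block_proj n (\<lambda>l. \<alpha> l * m l) i * U =
           mat n n (\<lambda>(x, y). if x = y \<and> x \<in> v i then 1 else 0))"

end

theory Submission
  imports Defs
begin

text \<open>
  Since \<open>S\<^sub>G\<close> contains all \<open>\<epsilon>\<^sub>y\<^sub>w\<close> with \<open>y \<simeq> w\<close>, \<open>a\<close> and \<open>a\<^sup>*\<close> both multiply \<open>S\<^sub>G\<close> into itself
  exactly when \<open>a\<^sub>x\<^sub>y \<noteq> 0\<close> forces \<open>x\<close> and \<open>y\<close> to be true twins.  The commutant of this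
  multiplier algebra consists of the diagonal matrices that are constant on the twin classes.
  As it is commutative, every decomposition \<open>\<Oplus>\<^sub>i (M\<^bsub>\<alpha> i\<^esub> \<otimes> I\<^bsub>m i\<^esub>)\<close> of the multiplier algebra has
  \<open>m i = 1\<close>, and comparing minimal central projections matches the summands with the twin classes.
  Compressing by these projections, the corner entry of the \<open>(i, j)\<close> block of \<open>U S\<^sub>G U\<^sup>*\<close> is arbitrary
  if the classes \<open>i\<close> and \<open>j\<close> are adjacent or equal, and zero otherwise.
\<close>

section \<open>Matrices supported on a relation\<close>

text \<open>The unitary \<open>U\<close> of a decomposition is far from unique: even for a fixed
  order of the summands it can be followed by any unitary of each factor \<open>M_\<alpha>\<close>,
  so nothing can be read off from its entries. The argument therefore uses only what survives
  conjugation: products, commutants and the projections onto the summands. A single corner entry of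
  \<open>U s U*\<close> does depend on \<open>U\<close>, but the set of values it takes as
  \<open>s\<close> runs over the operator system does not.

  All the spaces that occur consist of the matrices whose entries vanish off some relation on
  indices, so closure under products and adjoints and the form of commutants become statements about
  relations. The algebra generated by the operator system never has to be computed: true twins are
  adjacent or equal, so the candidate multipliers already lie in the operator system itself.

  The decompositions are used in two directions. A prescribed numbering of the classes yields one
  through a permutation matrix, while an arbitrary one determines its own numbering; the computation
  of the skeleton is shared.\<close>

lemma mat_adjoint_index:
  fixes A :: "complex mat"
  assumes "i < dim_col A" "j < dim_row A"
  shows "mat_adjoint A $$ (i, j) = cnj (A $$ (j, i))"
  using assms by (simp add: mat_adjoint_def mat_of_rows_def)

lemma mat_adjoint_carrier [simp]:
  fixes A :: "complex mat"
  assumes "A \<in> carrier_mat nr nc"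
  shows "mat_adjoint A \<in> carrier_mat nc nr"
  using assms by (auto simp: mat_adjoint_def mat_of_rows_def)

lemma times_mat_index:
  fixes A :: "complex mat"
  assumes "A \<in> carrier_mat n m" "B \<in> carrier_mat m l" "i < n" "j < l"
  shows "(A * B) $$ (i, j) = (\<Sum>x<m. A $$ (i, x) * B $$ (x, j))"
  using assms by (auto simp: scalar_prod_def lessThan_atLeast0 intro!: sum.cong)

lemma mat_unit_carrier [simp]: "mat_unit nr nc x y \<in> carrier_mat nr nc"
  by (simp add: mat_unit_def)

lemma mat_unit_index [simp]:
  "i < nr \<Longrightarrow> j < nc \<Longrightarrow> mat_unit nr nc x y $$ (i, j) = (if i = x \<and> j = y then 1 else 0)"
  by (simp add: mat_unit_def)

lemma times_mat_unit_index:
  assumes "A \<in> carrier_mat n n" "x < n" "y < n" "i < n" "j < n"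
  shows "(A * mat_unit n n x y) $$ (i, j) = (if j = y then A $$ (i, x) else 0)"
proof -
  have "(A * mat_unit n n x y) $$ (i, j) = (\<Sum>l<n. if l = x then (if j = y then A $$ (i, x) else 0) else 0)"
    by (subst times_mat_index[where m = n and n = n and l = n])
      (rule assms mat_unit_carrier sum.cong[OF refl] | auto simp: assms)+
  then show ?thesis using assms by (simp add: sum.delta)
qed

lemma mat_unit_times_index:
  assumes "A \<in> carrier_mat n n" "x < n" "y < n" "i < n" "j < n"
  shows "(mat_unit n n x y * A) $$ (i, j) = (if i = x then A $$ (y, j) else 0)"
proof -
  have "(mat_unit n n x y * A) $$ (i, j) = (\<Sum>l<n. if l = y then (if i = x then A $$ (y, j) else 0) else 0)"
    by (subst times_mat_index[where m = n and n = n and l = n])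
      (rule assms mat_unit_carrier sum.cong[OF refl] | auto simp: assms)+
  then show ?thesis using assms by (simp add: sum.delta)
qed

lemma diagonal_times_index:
  fixes A :: "complex mat"
  assumes "D \<in> carrier_mat n n" "\<And>x y. x < n \<Longrightarrow> y < n \<Longrightarrow> x \<noteq> y \<Longrightarrow> D $$ (x, y) = 0"
    and "A \<in> carrier_mat n l" "i < n" "j < l"
  shows "(D * A) $$ (i, j) = D $$ (i, i) * A $$ (i, j)"
proof -
  have "(D * A) $$ (i, j) = (\<Sum>x<n. if x = i then D $$ (i, i) * A $$ (i, j) else 0)"
    by (subst times_mat_index[where m = n and n = n and l = l])
      (rule assms(1,3-5) sum.cong[OF refl] | auto simp: assms)+
  then show ?thesis using assms by (simp add: sum.delta)
qed

lemma times_diagonal_index: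
  fixes A :: "complex mat"
  assumes "D \<in> carrier_mat n n" "\<And>x y. x < n \<Longrightarrow> y < n \<Longrightarrow> x \<noteq> y \<Longrightarrow> D $$ (x, y) = 0"
    and "A \<in> carrier_mat l n" "i < l" "j < n"
  shows "(A * D) $$ (i, j) = A $$ (i, j) * D $$ (j, j)"
proof -
  have "(A * D) $$ (i, j) = (\<Sum>x<n. if x = j then A $$ (i, j) * D $$ (j, j) else 0)"
    by (subst times_mat_index[where m = n and n = l and l = n])
      (rule assms(1,3-5) sum.cong[OF refl] | auto simp: assms)+
  then show ?thesis using assms by (simp add: sum.delta)
qed

text \<open>Reflexive symmetric relations give operator systems, equivalence relations give algebras
  that are block diagonal after reordering the basis, and equality gives the diagonal
  matrices.\<close>

definition pattern_space :: "nat \<Rightarrow> (nat \<Rightarrow> nat \<Rightarrow> bool) \<Rightarrow> complex mat set" where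
  "pattern_space n P = {X \<in> carrier_mat n n. \<forall>x<n. \<forall>y<n. \<not> P x y \<longrightarrow> X $$ (x, y) = 0}"

lemma pattern_space_carrier: "X \<in> pattern_space n P \<Longrightarrow> X \<in> carrier_mat n n"
  by (simp add: pattern_space_def)

lemma pattern_space_zero: "X \<in> pattern_space n P \<Longrightarrow> x < n \<Longrightarrow> y < n \<Longrightarrow> \<not> P x y \<Longrightarrow> X $$ (x, y) = 0"
  by (simp add: pattern_space_def)

lemma pattern_space_cong:
  "(\<And>x y. x < n \<Longrightarrow> y < n \<Longrightarrow> P x y = Q x y) \<Longrightarrow> pattern_space n P = pattern_space n Q"
  by (auto simp: pattern_space_def)

lemma mat_unit_pattern_space: "P x y \<Longrightarrow> mat_unit n n x y \<in> pattern_space n P"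
  by (auto simp: pattern_space_def)

lemma pattern_space_adjoint:
  assumes "\<And>x y. x < n \<Longrightarrow> y < n \<Longrightarrow> P x y \<Longrightarrow> P y x" "X \<in> pattern_space n P"
  shows "mat_adjoint X \<in> pattern_space n P"
  unfolding pattern_space_def
proof (intro CollectI conjI allI impI)
  have X: "X \<in> carrier_mat n n" using assms(2) by (rule pattern_space_carrier)
  show "mat_adjoint X \<in> carrier_mat n n" using X by (rule mat_adjoint_carrier)
  fix x y assume "x < n" "y < n" "\<not> P x y"
  then show "mat_adjoint X $$ (x, y) = 0"
    using X assms pattern_space_zero[OF assms(2), of y x] by (auto simp: mat_adjoint_index)
qed

text \<open>A nonzero term in the sum for entry \<open>(x, z)\<close> passes through an index
  \<open>y\<close> allowed by both factors, so the support of a product lies in the composite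
  relation. Three separate relations let the lemma serve both the bimodule condition and
  multipliers.\<close>

lemma pattern_space_mult:
  assumes "\<And>x y z. x < n \<Longrightarrow> y < n \<Longrightarrow> z < n \<Longrightarrow> P x y \<Longrightarrow> Q y z \<Longrightarrow> R x z"
    and "X \<in> pattern_space n P" "Y \<in> pattern_space n Q"
  shows "X * Y \<in> pattern_space n R"
proof -
  have c: "X \<in> carrier_mat n n" "Y \<in> carrier_mat n n" using assms by (auto dest: pattern_space_carrier)
  have "(X * Y) $$ (x, z) = 0" if "x < n" "z < n" "\<not> R x z" for x z
  proof -
    have "X $$ (x, y) * Y $$ (y, z) = 0" if "y < n" for y
      using assms(1)[OF \<open>x < n\<close> that \<open>z < n\<close>] \<open>\<not> R x z\<close> \<open>x < n\<close> \<open>z < n\<close> that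
        pattern_space_zero[OF assms(2), of x y] pattern_space_zero[OF assms(3), of y z] by auto
    then show ?thesis using that by (subst times_mat_index[OF c]) (auto intro!: sum.neutral)
  qed
  then show ?thesis using c by (auto simp: pattern_space_def)
qed

lemma pattern_space_submodule:
  "submodule class_ring (pattern_space n P) (module_mat TYPE(complex) n n)"
proof -
  interpret matrix_vs n n "TYPE(complex)" .
  show ?thesis
    by (rule submodule.intro)
      (auto simp: pattern_space_def module_mat_simps class_ring_simps module_axioms)
qed

lemma pattern_space_subspace:
  "VectorSpace.subspace class_ring (pattern_space n P) (module_mat TYPE(complex) n n)"
  using pattern_space_submodule matrix_vs by (auto simp: subspace_def)

text \<open>The induction is on a finite set \<open>F\<close> of positions containing the support of
  \<open>X\<close>: dropping one position from \<open>F\<close> splits off one multiple of a matrix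
  unit. At the end \<open>F\<close> is the whole index square.\<close>

lemma span_mat_units:
  "LinearCombinations.module.span class_ring (module_mat TYPE(complex) n n)
     {mat_unit n n x y | x y. x < n \<and> y < n \<and> P x y} = pattern_space n P"
proof -
  interpret matrix_vs n n "TYPE(complex)" .
  let ?B = "{mat_unit n n x y | x y. x < n \<and> y < n \<and> P x y}"
  have B: "?B \<subseteq> carrier_mat n n" by auto
  have sub: "submodule class_ring (span ?B) V"
    by (rule span_is_submodule) (use B in auto)
  have add: "X + Y \<in> span ?B" if "X \<in> span ?B" "Y \<in> span ?B" for X Y
    using submodule.m_closed[OF sub that] by (simp add: module_mat_simps)
  have smult: "c \<cdot>\<^sub>m Y \<in> span ?B" if "Y \<in> span ?B" for c Y
    using submodule.smult_closed[OF sub, of c Y] that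
    by (simp only: module_mat_simps partial_object.select_convs UNIV_I simp_thms)
  have zero: "0\<^sub>m n n \<in> span ?B"
    using submodule.zero_closed[OF sub] by (simp add: module_mat_simps)
  have "X \<in> span ?B"
    if "finite F" "X \<in> pattern_space n (\<lambda>x y. P x y \<and> (x, y) \<in> F)" for F X
    using that
  proof (induction F arbitrary: X rule: finite_induct)
    case empty
    then have "X = 0\<^sub>m n n" by (auto simp: pattern_space_def)
    then show ?case using zero by simp
  next
    case (insert p F)
    obtain x y where p: "p = (x, y)" by (cases p)
    have X: "X \<in> carrier_mat n n" using insert.prems by (rule pattern_space_carrier)
    show ?case
    proof (cases "x < n \<and> y < n \<and> P x y")
      case True
      define Y where "Y = mat n n (\<lambda>(i, j). if (i, j) = (x, y) then 0 else X $$ (i, j))"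
      have "Y \<in> span ?B"
        by (rule insert.IH) (use insert.prems p in \<open>auto simp: Y_def pattern_space_def\<close>)
      moreover have "X $$ (x, y) \<cdot>\<^sub>m mat_unit n n x y \<in> span ?B"
        by (rule smult, rule subsetD[OF in_own_span]) (use B True in blast)+
      moreover have "X = Y + X $$ (x, y) \<cdot>\<^sub>m mat_unit n n x y"
        by (rule eq_matI) (use X in \<open>auto simp: Y_def mat_unit_def\<close>)
      ultimately show ?thesis using add[of Y "X $$ (x, y) \<cdot>\<^sub>m mat_unit n n x y"] by presburger
    next
      case False
      then have "X \<in> pattern_space n (\<lambda>x y. P x y \<and> (x, y) \<in> F)"
        using insert.prems p unfolding pattern_space_def by blast
      then show ?thesis by (rule insert.IH)
    qed
  qed
  moreover have "pattern_space n (\<lambda>x y. P x y \<and> (x, y) \<in> {..<n} \<times> {..<n}) = pattern_space n P"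
    by (rule pattern_space_cong) auto
  ultimately have "pattern_space n P \<subseteq> span ?B"
    using finite_lessThan finite_cartesian_product by blast
  moreover have "span ?B \<subseteq> pattern_space n P"
    by (rule span_is_subset[OF _ pattern_space_submodule]) (auto intro: mat_unit_pattern_space)
  ultimately show ?thesis by blast
qed

section \<open>Graph operator systems as quantum graphs, and their multipliers\<close>

lemma graph_system_eq_pattern_space:
  assumes "pverts G = {0..<n}"
  shows "graph_system n G = pattern_space n (adj_eq G)"
  using assms span_mat_units[of n "adj_eq G"] by (simp add: graph_system_def)

lemma diagonal_algebra_eq_pattern_space: "diagonal_algebra n = pattern_space n (=)"
  by (auto simp: diagonal_algebra_def pattern_space_def diagonal_mat_def)

lemma operator_system_pattern_space:
  assumes "\<And>x. x < n \<Longrightarrow> P x x" "\<And>x y. x < n \<Longrightarrow> y < n \<Longrightarrow> P x y \<Longrightarrow> P y x"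
  shows "operator_system n (pattern_space n P)"
  unfolding operator_system_def
proof (intro conjI ballI)
  show "mat_adjoint s \<in> pattern_space n P" if "s \<in> pattern_space n P" for s
    by (rule pattern_space_adjoint[OF assms(2) that])
qed (use assms(1) pattern_space_subspace in \<open>auto simp: pattern_space_def\<close>)

text \<open>Commuting with \<epsilon>_xy is compared in row \<open>x\<close>: one side gives row
  \<open>y\<close> of \<open>b\<close>, the other only \<open>b $$ (x, x)\<close> in column
  \<open>y\<close>. The units \<epsilon>_xx, present by reflexivity, make \<open>b\<close> diagonal,
  and the remaining units equate its diagonal entries along \<open>E\<close>. Conversely, for
  diagonal \<open>b\<close> the commutator has entries a_ij (b_jj - b_ii).\<close>

lemma commutant_pattern_space:
  assumes refl: "\<And>x. x < n \<Longrightarrow> E x x"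
  shows "mat_commutant n (pattern_space n E) =
    {Z \<in> pattern_space n (=). \<forall>x<n. \<forall>y<n. E x y \<longrightarrow> Z $$ (x, x) = Z $$ (y, y)}" (is "_ = ?Z")
proof
  show "mat_commutant n (pattern_space n E) \<subseteq> ?Z"
  proof
    fix b assume b: "b \<in> mat_commutant n (pattern_space n E)"
    then have bc: "b \<in> carrier_mat n n" by (simp add: mat_commutant_def)
    have key: "b $$ (y, w) = (if w = y then b $$ (x, x) else 0)" if "x < n" "y < n" "w < n" "E x y" for x y w
    proof -
      have "mat_unit n n x y * b = b * mat_unit n n x y"
        using b that by (auto simp: mat_commutant_def intro: mat_unit_pattern_space)
      from arg_cong[OF this, of "\<lambda>M. M $$ (x, w)"] show ?thesis
        using that bc by (simp add: times_mat_unit_index mat_unit_times_index)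
    qed
    have "b $$ (x, y) = 0" if "x < n" "y < n" "x \<noteq> y" for x y
      using key[of x x y] that refl by simp
    moreover have "b $$ (x, x) = b $$ (y, y)" if "x < n" "y < n" "E x y" for x y
      using key[of x y y] that by simp
    ultimately show "b \<in> ?Z"
      using bc by (auto simp: pattern_space_def)
  qed
  show "?Z \<subseteq> mat_commutant n (pattern_space n E)"
  proof
    fix b assume b: "b \<in> ?Z"
    then have bc: "b \<in> carrier_mat n n" by (auto dest: pattern_space_carrier)
    have "a * b = b * a" if a: "a \<in> pattern_space n E" for a
    proof (rule eq_matI)
      have ac: "a \<in> carrier_mat n n" using a by (rule pattern_space_carrier)
      fix i j assume "i < dim_row (b * a)" "j < dim_col (b * a)"
      then have ij: "i < n" "j < n" using ac bc by auto
      have "(a * b) $$ (i, j) = a $$ (i, j) * b $$ (j, j)"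
        using b ac bc ij by (intro times_diagonal_index) (auto simp: pattern_space_def)
      also have "\<dots> = b $$ (i, i) * a $$ (i, j)"
        using b a ij by (cases "E i j") (auto simp: pattern_space_zero)
      also have "\<dots> = (b * a) $$ (i, j)"
        using b ac bc ij by (intro diagonal_times_index[symmetric]) (auto simp: pattern_space_def)
      finally show "(a * b) $$ (i, j) = (b * a) $$ (i, j)" .
    qed (use bc a in \<open>auto dest: pattern_space_carrier\<close>)
    with bc show "b \<in> mat_commutant n (pattern_space n E)" by (simp add: mat_commutant_def)
  qed
qed

text \<open>For \<open>E\<close> equality the condition on the diagonal entries is vacuous: the
  diagonal matrices are maximal abelian.\<close>

lemma commutant_diagonal_algebra: "mat_commutant n (diagonal_algebra n) = diagonal_algebra n"
  by (auto simp: diagonal_algebra_eq_pattern_space commutant_pattern_space)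

lemma von_neumann_diagonal_algebra: "von_neumann_algebra n (diagonal_algebra n)"
  unfolding von_neumann_algebra_def commutant_diagonal_algebra
  using pattern_space_adjoint[of n "(=)"]
  by (auto simp: diagonal_algebra_eq_pattern_space dest: pattern_space_carrier)

text \<open>Because \<open>D_n\<close> is its own commutant, the bimodule condition only concerns
  multiplication by diagonal matrices, which rescales rows and columns and cannot enlarge a
  support.\<close>

lemma quantum_graph_pattern_space:
  assumes "\<And>x. x < n \<Longrightarrow> P x x" "\<And>x y. x < n \<Longrightarrow> y < n \<Longrightarrow> P x y \<Longrightarrow> P y x"
  shows "quantum_graph n (pattern_space n P, diagonal_algebra n)"
  unfolding quantum_graph_def prod.case commutant_diagonal_algebra
proof (intro conjI ballI)
  fix a s b
  assume "a \<in> diagonal_algebra n" "s \<in> pattern_space n P" "b \<in> diagonal_algebra n"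
  then show "a * s * b \<in> pattern_space n P"
    unfolding diagonal_algebra_eq_pattern_space
    by (intro pattern_space_mult[where P = P and Q = "(=)", of n P]
        pattern_space_mult[where P = "(=)" and Q = P]) auto
qed (use assms in \<open>auto intro: von_neumann_diagonal_algebra operator_system_pattern_space\<close>)

text \<open>If \<open>P y z\<close>, then a \<epsilon>_yz carries a_xy to position
  \<open>(x, z)\<close>; so a_xy \<noteq> 0 transfers the \<open>P\<close>-neighbours of
  \<open>y\<close> to \<open>x\<close>, and the adjoint transfers them back. Conversely,
  \<open>z = y\<close> in \<open>?E x y\<close> and reflexivity give \<open>P x y\<close>, so the
  matrices supported on \<open>?E\<close> lie in the operator system and hence in every algebra
  containing it.\<close>

lemma multiplier_algebra_pattern_space:
  assumes refl: "\<And>x. x < n \<Longrightarrow> P x x" and sym: "\<And>x y. x < n \<Longrightarrow> y < n \<Longrightarrow> P x y \<Longrightarrow> P y x"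
  shows "multiplier_algebra n (pattern_space n P) =
    pattern_space n (\<lambda>x y. \<forall>z<n. P x z \<longleftrightarrow> P y z)" (is "_ = pattern_space n ?E")
proof
  show "multiplier_algebra n (pattern_space n P) \<subseteq> pattern_space n ?E"
  proof
    fix a assume a: "a \<in> multiplier_algebra n (pattern_space n P)"
    have left: "a * s \<in> pattern_space n P" "mat_adjoint a * s \<in> pattern_space n P"
      if "s \<in> pattern_space n P" for s
      using a that by (auto simp: multiplier_algebra_def)
    \<comment> \<open>The full matrix algebra is one of the algebras being intersected in
      \<open>Cstar_generated\<close>; this is what yields that \<open>a\<close> has the right
      dimensions.\<close>
    have "pattern_space n (\<lambda>_ _. True) = carrier_mat n n"
      by (auto simp: pattern_space_def)
    then have "star_subalgebra n (carrier_mat n n)"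
      unfolding star_subalgebra_def using pattern_space_subspace[of n "\<lambda>_ _. True"] by auto
    then have ac: "a \<in> carrier_mat n n"
      using a by (auto simp: multiplier_algebra_def Cstar_generated_def pattern_space_def)
    have sub: "P x z" if "A \<in> carrier_mat n n" "\<And>s. s \<in> pattern_space n P \<Longrightarrow> A * s \<in> pattern_space n P"
      "A $$ (x, y) \<noteq> 0" "x < n" "y < n" "z < n" "P y z" for A x y z
    proof -
      have "A * mat_unit n n y z \<in> pattern_space n P"
        using that mat_unit_pattern_space by blast
      then show ?thesis
        using that times_mat_unit_index[of A n y z x z] pattern_space_zero by fastforce
    qed
    have "?E x y" if xy: "x < n" "y < n" "a $$ (x, y) \<noteq> 0" for x y
    proof (intro allI impI iffI)
      fix z assume "z < n"
      show "P x z" if "P y z" using sub[OF ac left(1)] xy that \<open>z < n\<close> by blast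
      have "mat_adjoint a $$ (y, x) \<noteq> 0" using xy ac by (simp add: mat_adjoint_index)
      then show "P y z" if "P x z"
        using sub[OF mat_adjoint_carrier[OF ac] left(2)] xy that \<open>z < n\<close> by blast
    qed
    then show "a \<in> pattern_space n ?E" using ac by (auto simp: pattern_space_def)
  qed
  show "pattern_space n ?E \<subseteq> multiplier_algebra n (pattern_space n P)"
  proof
    fix a assume a: "a \<in> pattern_space n ?E"
    then have a': "mat_adjoint a \<in> pattern_space n ?E"
      by (rule pattern_space_adjoint[rotated]) auto
    have "a \<in> pattern_space n P"
      unfolding pattern_space_def
    proof (intro CollectI conjI allI impI)
      fix x y assume "x < n" "y < n" "\<not> P x y"
      then show "a $$ (x, y) = 0" using refl by (intro pattern_space_zero[OF a]) auto
    qed (use a in \<open>rule pattern_space_carrier\<close>)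
    then have "a \<in> Cstar_generated n (pattern_space n P)" by (auto simp: Cstar_generated_def)
    moreover have "b * s \<in> pattern_space n P" if "b \<in> pattern_space n ?E" "s \<in> pattern_space n P" for b s
      by (rule pattern_space_mult[OF _ that]) auto
    ultimately show "a \<in> multiplier_algebra n (pattern_space n P)"
      using a a' by (auto simp: multiplier_algebra_def)
  qed
qed

section \<open>Irreducibility\<close>

lemma vec_norm2_eq:
  assumes "w \<in> carrier_vec n"
  shows "vec_norm2 w = sqrt (\<Sum>i<n. (cmod (w $ i))\<^sup>2)"
proof -
  have "Re (w \<bullet>c w) = (\<Sum>i<n. (cmod (w $ i))\<^sup>2)"
    using assms
    by (auto simp: scalar_prod_def lessThan_atLeast0 complex_norm_square[symmetric] cmod_power2 power2_eq_square intro!: sum.cong)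
  then show ?thesis by (simp add: vec_norm2_def)
qed

lemma vec_norm2_smult_unit_vec:
  assumes "x < n"
  shows "vec_norm2 (c \<cdot>\<^sub>v unit_vec n x) = cmod c"
proof -
  have "vec_norm2 (c \<cdot>\<^sub>v unit_vec n x) = sqrt (\<Sum>i<n. if i = x then (cmod c)\<^sup>2 else 0)"
    unfolding vec_norm2_eq[of "c \<cdot>\<^sub>v unit_vec n x" n, simplified]
    using assms by (intro arg_cong[where f = sqrt] sum.cong) auto
  then show ?thesis using assms by (simp add: sum.delta)
qed

lemma component_le_vec_norm2:
  assumes "w \<in> carrier_vec n" "x < n"
  shows "cmod (w $ x) \<le> vec_norm2 w"
proof -
  have "(cmod (w $ x))\<^sup>2 \<le> (\<Sum>i<n. (cmod (w $ i))\<^sup>2)"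
    using assms(2) by (intro member_le_sum) auto
  then show ?thesis
    unfolding vec_norm2_eq[OF assms(1)] by (rule real_le_rsqrt)
qed

lemma mat_unit_mult_vec:
  assumes "w \<in> carrier_vec n" "x < n"
  shows "mat_unit n n x x *\<^sub>v w = w $ x \<cdot>\<^sub>v unit_vec n x"
proof (rule eq_vecI)
  fix i assume "i < dim_vec (w $ x \<cdot>\<^sub>v unit_vec n x)"
  then have i: "i < n" by simp
  have "(mat_unit n n x x *\<^sub>v w) $ i = (\<Sum>j<n. (if i = x \<and> j = x then 1 else 0) * w $ j)"
    using assms(1) i by (simp add: mat_unit_def scalar_prod_def lessThan_atLeast0)
  also have "\<dots> = (\<Sum>j<n. if j = x then (if i = x then w $ x else 0) else 0)"
    by (intro sum.cong) auto
  finally show "(mat_unit n n x x *\<^sub>v w) $ i = (w $ x \<cdot>\<^sub>v unit_vec n x) $ i"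
    using assms i by (simp add: sum.delta)
qed (simp add: mat_unit_def)

lemma subspace_contains_all:
  assumes sub: "VectorSpace.subspace class_ring L (module_vec TYPE(complex) n)"
    and units: "\<And>x. x < n \<Longrightarrow> unit_vec n x \<in> L"
  shows "L = carrier_vec n"
proof -
  have submod: "submodule class_ring L (module_vec TYPE(complex) n)"
    using sub by (simp add: VectorSpace.subspace_def)
  have sum: "v + w \<in> L" if "v \<in> L" "w \<in> L" for v w
    using submodule.m_closed[OF submod that] by (simp add: module_vec_simps)
  have smult: "c \<cdot>\<^sub>v v \<in> L" if "v \<in> L" for c v
    using submodule.smult_closed[OF submod, of c v] that by (simp add: module_vec_simps)
  have zero: "0\<^sub>v n \<in> L"
    using submodule.zero_closed[OF submod] by (simp add: module_vec_simps)
  have "v \<in> L" if v: "v \<in> carrier_vec n" for v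
  proof -
    \<comment> \<open>Truncations of \<open>v\<close> grow by one scaled unit vector at a
      time.\<close>
    have "vec n (\<lambda>i. if i < k then v $ i else 0) \<in> L" if "k \<le> n" for k
      using that
    proof (induction k)
      case 0
      have "vec n (\<lambda>i. if i < 0 then v $ i else 0) = 0\<^sub>v n" by auto
      then show ?case using zero by simp
    next
      case (Suc k)
      have "vec n (\<lambda>i. if i < Suc k then v $ i else 0)
          = vec n (\<lambda>i. if i < k then v $ i else 0) + v $ k \<cdot>\<^sub>v unit_vec n k"
        using Suc.prems by (intro eq_vecI) (auto simp: less_Suc_eq)
      moreover have "v $ k \<cdot>\<^sub>v unit_vec n k \<in> L" using Suc.prems units by (intro smult) auto
      ultimately show ?case using Suc sum by simp
    qed
    from this[of n] have "vec n (\<lambda>i. if i < n then v $ i else 0) \<in> L" by simp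
    moreover have "vec n (\<lambda>i. if i < n then v $ i else 0) = v" using v by auto
    ultimately show ?thesis by simp
  qed
  moreover have "L \<subseteq> carrier_vec n"
    using submodule.subset[OF submod] by (simp add: module_vec_simps)
  ultimately show ?thesis by blast
qed

text \<open>A proper subspace reducing all the diagonal matrix units misses a coordinate \<open>x\<close>,
  and then restriction to it kills \<open>\<epsilon>\<^sub>x\<^sub>x\<close>.\<close>

lemma acts_irreducibly_pattern_space:
  assumes refl: "\<And>x. x < n \<Longrightarrow> P x x"
  shows "acts_irreducibly n (pattern_space n P)"
  unfolding acts_irreducibly_def
proof (rule notI, elim exE conjE)
  fix L
  assume sub: "VectorSpace.subspace class_ring L (module_vec TYPE(complex) n)"
    and proper: "L \<noteq> carrier_vec n" and red: "reduces L (pattern_space n P)"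
    and iso: "restriction_completely_isometric n (pattern_space n P) L"
  have submod: "submodule class_ring L (module_vec TYPE(complex) n)"
    using sub by (simp add: VectorSpace.subspace_def)
  have smult: "c \<cdot>\<^sub>v v \<in> L" if "v \<in> L" for c v
    using submodule.smult_closed[OF submod, of c v] that by (simp add: module_vec_simps)
  have zero: "0\<^sub>v n \<in> L"
    using submodule.zero_closed[OF submod] by (simp add: module_vec_simps)
  have Lc: "L \<subseteq> carrier_vec n"
    using submodule.subset[OF submod] by (simp add: module_vec_simps)
  have units: "mat_unit n n x x \<in> pattern_space n P" if "x < n" for x
    using refl that by (simp add: mat_unit_pattern_space)
  \<comment> \<open>Otherwise each \<epsilon>_xx, applied to a vector of \<open>L\<close> with
    nonzero coordinate \<open>x\<close>, gives a multiple of a unit vector, and \<open>L\<close> is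
    everything.\<close>
  have "\<exists>x<n. \<forall>w\<in>L. w $ x = 0"
  proof (rule ccontr)
    assume none: "\<not> (\<exists>x<n. \<forall>w\<in>L. w $ x = 0)"
    have "unit_vec n x \<in> L" if x: "x < n" for x
    proof -
      obtain w where w: "w \<in> L" "w $ x \<noteq> 0" using none x by blast
      have "mat_unit n n x x *\<^sub>v w \<in> L" using red units[OF x] w(1) by (simp add: reduces_def)
      then have "w $ x \<cdot>\<^sub>v unit_vec n x \<in> L" using mat_unit_mult_vec[of w n x] w Lc x by auto
      then have "inverse (w $ x) \<cdot>\<^sub>v (w $ x \<cdot>\<^sub>v unit_vec n x) \<in> L" by (rule smult)
      then show ?thesis using w(2) by (simp add: smult_smult_assoc)
    qed
    then show False using proper subspace_contains_all[OF sub] by blast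
  qed
  then obtain x where x: "x < n" and vanish: "\<And>w. w \<in> L \<Longrightarrow> w $ x = 0" by blast
  let ?T = "mat_unit n n x x"
  \<comment> \<open>Complete isometry already fails at level one: for \<open>m = 1\<close> the only
    block of \<open>?T\<close> is \<open>?T\<close>, and the amplified subspace is
    \<open>L\<close>.\<close>
  have "mat_block (\<lambda>_. n) 0 0 ?T = ?T"
    by (rule eq_matI) (auto simp: mat_block_def block_start_def mat_unit_def)
  then have "\<forall>p<1. \<forall>q<1. mat_block (\<lambda>_. n) p q ?T \<in> pattern_space n P"
    using units[OF x] by simp
  moreover have "?T \<in> carrier_mat (1 * n) (1 * n)" by simp
  ultimately have eq: "norm_on (amplify 1 n L) ?T = norm_on (carrier_vec n) ?T"
    using iso unfolding restriction_completely_isometric_def by (metis mult_1)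
  have "vec_block (\<lambda>_. n) 0 w = w" if "w \<in> carrier_vec n" for w
    using that by (auto simp: vec_block_def block_start_def)
  then have "amplify 1 n L = L" using Lc by (auto simp: amplify_def)
  \<comment> \<open>The zero vector keeps the set nonempty, so its supremum is a genuine 0 rather
    than an unspecified value.\<close>
  moreover have "{vec_norm2 (?T *\<^sub>v w) | w. w \<in> L \<and> vec_norm2 w \<le> 1} = {0}"
  proof -
    have "vec_norm2 (0\<^sub>v n) = 0" by (simp add: vec_norm2_eq[of _ n])
    moreover have "vec_norm2 (?T *\<^sub>v w) = 0" if "w \<in> L" for w
      using that Lc vec_norm2_smult_unit_vec[OF x, of 0]
      by (subst mat_unit_mult_vec[OF _ x]) (auto simp: vanish[OF that])
    ultimately show ?thesis using zero by force
  qed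
  ultimately have "norm_on (amplify 1 n L) ?T = 0" by (simp add: norm_on_def)
  moreover have "1 \<le> norm_on (carrier_vec n) ?T"
    unfolding norm_on_def
  proof (rule cSup_upper)
    have "vec_norm2 (unit_vec n x) = 1" using vec_norm2_smult_unit_vec[OF x, of 1] by simp
    moreover have "?T *\<^sub>v unit_vec n x = unit_vec n x" using x by (simp add: mat_unit_mult_vec)
    ultimately show "1 \<in> {vec_norm2 (?T *\<^sub>v w) | w. w \<in> carrier_vec n \<and> vec_norm2 w \<le> 1}"
      by (intro CollectI exI[of _ "unit_vec n x"]) simp
    \<comment> \<open>Without boundedness \<open>Sup\<close> over the reals would say nothing. The
      bound holds since \<epsilon>_xx keeps only one coordinate of \<open>w\<close>.\<close>
    show "bdd_above {vec_norm2 (?T *\<^sub>v w) | w. w \<in> carrier_vec n \<and> vec_norm2 w \<le> 1}"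
    proof (rule bdd_aboveI[of _ 1], elim CollectE exE conjE)
      fix t w assume "t = vec_norm2 (?T *\<^sub>v w)" "w \<in> carrier_vec n" "vec_norm2 w \<le> 1"
      then show "t \<le> 1"
        using x component_le_vec_norm2[of w n x]
        by (simp add: mat_unit_mult_vec vec_norm2_smult_unit_vec)
    qed
  qed
  ultimately show False using eq by simp
qed

section \<open>Block-diagonal matrices\<close>

lemma block_start_Suc: "block_start d (Suc i) = block_start d i + d i"
  by (simp add: block_start_def)

lemma block_start_mono: "i \<le> j \<Longrightarrow> block_start d i \<le> block_start d j"
  unfolding block_start_def by (rule sum_mono2) auto

lemma block_start_add_less:
  assumes "i < k" "a < d i"
  shows "block_start d i + a < block_start d k"
  using assms block_start_mono[of "Suc i" k d] by (simp add: block_start_Suc)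

text \<open>The inverse of the consecutive layout. Taking the least index also handles empty
  summands: minimality means that the previous block ends at or before \<open>r\<close>, so
  \<open>r\<close> really lies in the block found.\<close>

definition block_of :: "(nat \<Rightarrow> nat) \<Rightarrow> nat \<Rightarrow> nat" where
  "block_of d r = (LEAST i. r < block_start d (Suc i))"

lemma block_of_eqI:
  assumes "block_start d i \<le> r" "r < block_start d (Suc i)"
  shows "block_of d r = i"
  unfolding block_of_def
proof (rule Least_equality)
  show "r < block_start d (Suc i)" by (rule assms(2))
  fix j assume "r < block_start d (Suc j)"
  then show "i \<le> j" using assms(1) block_start_mono[of "Suc j" i d] by linarith
qed

lemma block_of_add [simp]: "a < d i \<Longrightarrow> block_of d (block_start d i + a) = i"
  by (rule block_of_eqI) (auto simp: block_start_Suc)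

lemma block_of_bounds:
  assumes "r < block_start d k"
  shows "block_of d r < k" "block_start d (block_of d r) \<le> r" "r < block_start d (Suc (block_of d r))"
proof -
  have k: "k \<noteq> 0" using assms by (cases k) (auto simp: block_start_def)
  then have ex: "r < block_start d (Suc (k - 1))" using assms by simp
  then show upper: "r < block_start d (Suc (block_of d r))" unfolding block_of_def by (rule LeastI)
  have "block_of d r \<le> k - 1" unfolding block_of_def using ex by (rule Least_le)
  then show "block_of d r < k" using k by linarith
  show "block_start d (block_of d r) \<le> r"
  proof (cases "block_of d r")
    case (Suc j)
    then have "\<not> r < block_start d (Suc j)"
      unfolding block_of_def by (metis not_less_Least lessI)
    then show ?thesis using Suc by simp
  qed (simp add: block_start_def)
qed

lemma block_decompE:
  assumes "r < block_start d k"
  obtains i a where "i < k" "a < d i" "r = block_start d i + a"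
  using that[of "block_of d r" "r - block_start d (block_of d r)"] block_of_bounds[OF assms]
  by (simp add: block_start_Suc)

lemma diag_block_mat_carrier:
  fixes c :: "nat \<Rightarrow> 'a :: zero mat"
  assumes "\<And>i. i < k \<Longrightarrow> c i \<in> carrier_mat (d i) (d i)"
  shows "diag_block_mat (map c [0..<k]) \<in> carrier_mat (block_start d k) (block_start d k)"
  using assms
proof (induction k)
  case (Suc k)
  then show ?case
    by (auto simp: diag_block_mat_last Let_def block_start_Suc intro!: four_block_carrier_mat)
qed (simp add: block_start_def)

lemma diag_block_mat_index:
  fixes c :: "nat \<Rightarrow> 'a :: zero mat"
  assumes "\<And>i. i < k \<Longrightarrow> c i \<in> carrier_mat (d i) (d i)"
    and "i < k" "j < k" "a < d i" "b < d j"
  shows "diag_block_mat (map c [0..<k]) $$ (block_start d i + a, block_start d j + b)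
    = (if i = j then c i $$ (a, b) else 0)"
  using assms
proof (induction k)
  case (Suc k)
  have D: "diag_block_mat (map c [0..<k]) \<in> carrier_mat (block_start d k) (block_start d k)"
    using Suc.prems by (intro diag_block_mat_carrier) auto
  have ck: "c k \<in> carrier_mat (d k) (d k)" using Suc.prems by simp
  have less: "block_start d i + a < block_start d k" if "i < k" "a < d i" for i a
    using that by (rule block_start_add_less)
  have IH: "diag_block_mat (map c [0..<k]) $$ (block_start d i + a, block_start d j + b)
    = (if i = j then c i $$ (a, b) else 0)" if "i < k" "j < k"
    using Suc that by simp
  have full: "diag_block_mat (map c [0..<Suc k]) =
      four_block_mat (diag_block_mat (map c [0..<k])) (0\<^sub>m (block_start d k) (d k))
        (0\<^sub>m (d k) (block_start d k)) (c k)"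
    using D ck by (simp add: diag_block_mat_last Let_def)
  have "i < k \<or> i = k" "j < k \<or> j = k" using Suc.prems by auto
  then show ?case
    unfolding full
    using D ck Suc.prems(4,5) IH less[of i a] less[of j b]
    by (elim disjE) (auto simp: block_start_Suc)
qed simp

abbreviation same_block :: "(nat \<Rightarrow> nat) \<Rightarrow> nat \<Rightarrow> nat \<Rightarrow> bool" where
  "same_block d r s \<equiv> block_of d r = block_of d s"

lemma block_eq_matI:
  assumes "X \<in> carrier_mat (block_start d k) (block_start d k)"
    and "Y \<in> carrier_mat (block_start d k) (block_start d k)"
    and "\<And>i j a b. i < k \<Longrightarrow> j < k \<Longrightarrow> a < d i \<Longrightarrow> b < d j \<Longrightarrow>
      X $$ (block_start d i + a, block_start d j + b) = Y $$ (block_start d i + a, block_start d j + b)"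
  shows "X = Y"
proof (rule eq_matI)
  fix r s assume "r < dim_row Y" "s < dim_col Y"
  then have "r < block_start d k" "s < block_start d k" using assms(2) by auto
  then show "X $$ (r, s) = Y $$ (r, s)"
    by (elim block_decompE) (simp add: assms(3))
qed (use assms in auto)

text \<open>This puts a direct sum of full matrix algebras on the same footing as the multiplier
  algebra, with lying in the same block as the equivalence relation, so that one description of
  commutants covers both.\<close>

lemma block_diagonal_matrices_eq:
  fixes d :: "nat \<Rightarrow> nat"
  shows "{diag_block_mat (map c [0..<k]) | c :: nat \<Rightarrow> complex mat. \<forall>i<k. c i \<in> carrier_mat (d i) (d i)}
    = pattern_space (block_start d k) (same_block d)" (is "?L = ?R")
proof
  show "?L \<subseteq> ?R"
  proof (rule subsetI, elim CollectE exE conjE)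
    fix X and c :: "nat \<Rightarrow> complex mat" assume X: "X = diag_block_mat (map c [0..<k])"
      and c: "\<forall>i<k. c i \<in> carrier_mat (d i) (d i)"
    have "X $$ (r, s) = 0" if "r < block_start d k" "s < block_start d k" "\<not> same_block d r s" for r s
      using that c diag_block_mat_index[of k c d]
      by (elim block_decompE) (auto simp: X)
    moreover have "X \<in> carrier_mat (block_start d k) (block_start d k)"
      unfolding X by (rule diag_block_mat_carrier) (use c in auto)
    ultimately show "X \<in> ?R" by (auto simp: pattern_space_def)
  qed
  show "?R \<subseteq> ?L"
  proof
    fix X assume X: "X \<in> ?R"
    define c where "c i = mat_block d i i X" for i
    have c: "c i \<in> carrier_mat (d i) (d i)" for i by (simp add: c_def mat_block_def)
    have "X = diag_block_mat (map c [0..<k])"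
    proof (rule block_eq_matI[where d = d and k = k])
      show "X \<in> carrier_mat (block_start d k) (block_start d k)" using X by (rule pattern_space_carrier)
      show "diag_block_mat (map c [0..<k]) \<in> carrier_mat (block_start d k) (block_start d k)"
        using c by (intro diag_block_mat_carrier)
      fix i j a b assume ij: "i < k" "j < k" "a < d i" "b < d j"
      show "X $$ (block_start d i + a, block_start d j + b) =
          diag_block_mat (map c [0..<k]) $$ (block_start d i + a, block_start d j + b)"
        using ij c by (subst diag_block_mat_index)
          (auto simp: c_def mat_block_def block_start_add_less intro!: pattern_space_zero[OF X])
    qed
    with c show "X \<in> ?L" by blast
  qed
qed

lemma diag_block_mat_mult:
  fixes a b :: "nat \<Rightarrow> complex mat"
  assumes "\<And>i. i < k \<Longrightarrow> a i \<in> carrier_mat (d i) (d i)" "\<And>i. i < k \<Longrightarrow> b i \<in> carrier_mat (d i) (d i)"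
  shows "diag_block_mat (map a [0..<k]) * diag_block_mat (map b [0..<k])
    = diag_block_mat (map (\<lambda>i. a i * b i) [0..<k])"
  using assms
proof (induction k)
  case 0
  then show ?case by simp
next
  case (Suc k)
  let ?D = "\<lambda>c. diag_block_mat (map c [0..<k])"
  have D: "?D a \<in> carrier_mat (block_start d k) (block_start d k)"
    "?D b \<in> carrier_mat (block_start d k) (block_start d k)"
    "?D (\<lambda>i. a i * b i) \<in> carrier_mat (block_start d k) (block_start d k)"
    using Suc.prems mult_carrier_mat by (intro diag_block_mat_carrier; blast intro: less_SucI)+
  have k: "a k \<in> carrier_mat (d k) (d k)" "b k \<in> carrier_mat (d k) (d k)" using Suc.prems by auto
  have IH: "?D a * ?D b = ?D (\<lambda>i. a i * b i)" using Suc by auto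
  show ?case
    using D k IH
    by (simp add: diag_block_mat_last Let_def)
      (subst mult_four_block_mat[where ?n1.0 = "block_start d k" and ?n2.0 = "d k"
          and ?nr1.0 = "block_start d k" and ?nr2.0 = "d k" and ?nc1.0 = "block_start d k" and ?nc2.0 = "d k"];
        auto)
qed

section \<open>Kronecker products\<close>

lemma kron_carrier [simp]:
  "a \<in> carrier_mat p q \<Longrightarrow> b \<in> carrier_mat r s \<Longrightarrow> kron a b \<in> carrier_mat (p * r) (q * s)"
  by (auto simp: kron_def)

lemma kron_zero_right: "kron a (0\<^sub>m r s) = 0\<^sub>m (dim_row a * r) (dim_col a * s)"
proof (rule eq_matI)
  fix x y assume "x < dim_row (0\<^sub>m (dim_row a * r) (dim_col a * s) :: complex mat)"
    "y < dim_col (0\<^sub>m (dim_row a * r) (dim_col a * s) :: complex mat)"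
  then have xy: "x < dim_row a * r" "y < dim_col a * s" by auto
  then have "0 < r" "0 < s" by (auto intro: gr0I)
  then show "kron a (0\<^sub>m r s) $$ (x, y) = 0\<^sub>m (dim_row a * r) (dim_col a * s) $$ (x, y)"
    using xy by (simp add: kron_def)
qed (auto simp: kron_def)

lemma kron_one_right: "kron c (1\<^sub>m (Suc 0)) = c"
  by (rule eq_matI) (auto simp: kron_def)

lemma sum_div_mod:
  fixes f :: "nat \<Rightarrow> nat \<Rightarrow> 'a :: comm_monoid_add"
  shows "(\<Sum>l<q * r. f (l div r) (l mod r)) = (\<Sum>i<q. \<Sum>j<r. f i j)"
proof -
  have "(\<Sum>l<q * r. f (l div r) (l mod r)) = (\<Sum>i<q. \<Sum>l = i * r..<i * r + r. f (l div r) (l mod r))"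
    by (rule sum.nat_group[symmetric])
  also have "\<dots> = (\<Sum>i<q. \<Sum>j<r. f i j)"
  proof (rule sum.cong[OF refl])
    fix i
    have "(\<Sum>l = 0 + i * r..<r + i * r. f (l div r) (l mod r)) = (\<Sum>j = 0..<r. f ((j + i * r) div r) ((j + i * r) mod r))"
      by (rule sum.shift_bounds_nat_ivl)
    also have "\<dots> = (\<Sum>j<r. f i j)"
      by (auto simp: lessThan_atLeast0 intro!: sum.cong)
    finally show "(\<Sum>l = i * r..<i * r + r. f (l div r) (l mod r)) = (\<Sum>j<r. f i j)"
      by (simp add: add.commute)
  qed
  finally show ?thesis .
qed

text \<open>Quotient and remainder by \<open>r\<close> split the summation index into its two tensor
  legs, and the double sum factors.\<close>

lemma kron_mult:
  assumes "a \<in> carrier_mat p p" "a' \<in> carrier_mat p p" "b \<in> carrier_mat r r" "b' \<in> carrier_mat r r"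
  shows "kron a b * kron a' b' = kron (a * a') (b * b')"
proof (rule eq_matI)
  fix x y assume "x < dim_row (kron (a * a') (b * b'))" "y < dim_col (kron (a * a') (b * b'))"
  then have xy: "x < p * r" "y < p * r" using assms by (auto simp: kron_def)
  then have r: "r > 0" by (cases r) auto
  have div: "x div r < p" "y div r < p" using xy by (auto simp: less_mult_imp_div_less)
  have md: "x mod r < r" "y mod r < r" using r by auto
  have "(kron a b * kron a' b') $$ (x, y) = (\<Sum>l<p * r. kron a b $$ (x, l) * kron a' b' $$ (l, y))"
    using assms xy by (intro times_mat_index) auto
  also have "\<dots> = (\<Sum>l<p * r. (a $$ (x div r, l div r) * b $$ (x mod r, l mod r))
      * (a' $$ (l div r, y div r) * b' $$ (l mod r, y mod r)))"
    using assms xy by (intro sum.cong) (auto simp: kron_def)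
  also have "\<dots> = (\<Sum>i<p. \<Sum>j<r. (a $$ (x div r, i) * b $$ (x mod r, j))
      * (a' $$ (i, y div r) * b' $$ (j, y mod r)))"
    by (rule sum_div_mod)
  also have "\<dots> = (\<Sum>i<p. a $$ (x div r, i) * a' $$ (i, y div r)) * (\<Sum>j<r. b $$ (x mod r, j) * b' $$ (j, y mod r))"
    by (simp add: sum_product mult_ac)
  also have "\<dots> = (a * a') $$ (x div r, y div r) * (b * b') $$ (x mod r, y mod r)"
    using times_mat_index[OF assms(1,2) div] times_mat_index[OF assms(3,4) md] by simp
  also have "\<dots> = kron (a * a') (b * b') $$ (x, y)"
    using assms xy by (auto simp: kron_def)
  finally show "(kron a b * kron a' b') $$ (x, y) = kron (a * a') (b * b') $$ (x, y)" .
qed (use assms in \<open>auto simp: kron_def\<close>)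

section \<open>Unitary conjugation\<close>

definition conj_mat :: "complex mat \<Rightarrow> complex mat \<Rightarrow> complex mat" where
  "conj_mat U X = U * X * mat_adjoint U"

lemma mat_adjoint_adjoint [simp]: "mat_adjoint (mat_adjoint A) = (A :: complex mat)"
  by (rule eq_matI) (auto simp: mat_adjoint_def mat_of_rows_def)

lemma unitary_mat_carrier: "unitary_mat n U \<Longrightarrow> U \<in> carrier_mat n n"
  by (simp add: unitary_mat_def)

lemma unitary_mat_adjoint: "unitary_mat n U \<Longrightarrow> unitary_mat n (mat_adjoint U)"
  by (simp add: unitary_mat_def)

lemma conj_mat_carrier [simp]:
  "unitary_mat n U \<Longrightarrow> X \<in> carrier_mat n n \<Longrightarrow> conj_mat U X \<in> carrier_mat n n"
  unfolding conj_mat_def unitary_mat_def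
  by (intro mult_carrier_mat[of _ n n]) auto

lemma conj_mat_mult:
  assumes U: "unitary_mat n U" and X: "X \<in> carrier_mat n n" and Y: "Y \<in> carrier_mat n n"
  shows "conj_mat U X * conj_mat U Y = conj_mat U (X * Y)"
proof -
  have Uc: "U \<in> carrier_mat n n" and V: "mat_adjoint U \<in> carrier_mat n n"
    using U by (auto simp: unitary_mat_def)
  have "conj_mat U X * conj_mat U Y = U * X * (mat_adjoint U * (U * Y * mat_adjoint U))"
    unfolding conj_mat_def using Uc V X Y
    by (intro assoc_mult_mat[of _ n n _ n _ n] mult_carrier_mat[of _ n n]) auto
  also have "mat_adjoint U * (U * Y * mat_adjoint U) = mat_adjoint U * (U * (Y * mat_adjoint U))"
    using Uc V Y by (subst assoc_mult_mat[of U n n Y n _ n]) auto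
  also have "\<dots> = mat_adjoint U * U * (Y * mat_adjoint U)"
    using Uc V Y by (subst assoc_mult_mat[of "mat_adjoint U" n n U n _ n]) auto
  also have "\<dots> = Y * mat_adjoint U" using U V Y by (simp add: unitary_mat_def)
  also have "U * X * (Y * mat_adjoint U) = U * X * Y * mat_adjoint U"
    using Uc V X Y by (subst assoc_mult_mat[of "U * X" n n Y n _ n]) auto
  also have "U * X * Y = U * (X * Y)" using Uc X Y by (rule assoc_mult_mat)
  finally show ?thesis by (simp add: conj_mat_def)
qed

lemma conj_mat_cancel:
  assumes U: "unitary_mat n U" and X: "X \<in> carrier_mat n n"
  shows "conj_mat (mat_adjoint U) (conj_mat U X) = X"
proof -
  have Uc: "U \<in> carrier_mat n n" and V: "mat_adjoint U \<in> carrier_mat n n"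
    using U by (auto simp: unitary_mat_def)
  have "conj_mat (mat_adjoint U) (conj_mat U X) = mat_adjoint U * (U * X * mat_adjoint U) * U"
    by (simp add: conj_mat_def)
  also have "U * X * mat_adjoint U = U * (X * mat_adjoint U)"
    using Uc V X by (intro assoc_mult_mat[of _ n n _ n _ n]) auto
  also have "mat_adjoint U * (U * (X * mat_adjoint U)) = mat_adjoint U * U * (X * mat_adjoint U)"
    using Uc V X by (subst assoc_mult_mat[of "mat_adjoint U" n n U n _ n]) auto
  also have "\<dots> = X * mat_adjoint U" using U V X by (simp add: unitary_mat_def)
  also have "X * mat_adjoint U * U = X * (mat_adjoint U * U)"
    using Uc V X by (intro assoc_mult_mat[of _ n n _ n _ n]) auto
  also have "\<dots> = X" using U X by (simp add: unitary_mat_def)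
  finally show ?thesis .
qed

lemma conj_mat_cancel':
  assumes "unitary_mat n U" "X \<in> carrier_mat n n"
  shows "conj_mat U (conj_mat (mat_adjoint U) X) = X"
  using conj_mat_cancel[OF unitary_mat_adjoint, of n U X] assms by simp

lemma conj_mat_zero: "unitary_mat n U \<Longrightarrow> conj_mat U (0\<^sub>m n n) = 0\<^sub>m n n"
  unfolding conj_mat_def
  by (metis left_mult_zero_mat mat_adjoint_carrier right_mult_zero_mat unitary_mat_carrier)

text \<open>Conjugation by a unitary is a multiplicative bijection of the matrix algebra, so it
  preserves commuting pairs in both directions. This is the channel through which information passes
  an unknown \<open>U\<close>.\<close>

lemma commutant_conj_mat:
  assumes U: "unitary_mat n U" and A: "A \<subseteq> carrier_mat n n"
  shows "mat_commutant n (conj_mat U ` A) = conj_mat U ` mat_commutant n A"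
proof
  have V: "unitary_mat n (mat_adjoint U)" using U by (rule unitary_mat_adjoint)
  show "mat_commutant n (conj_mat U ` A) \<subseteq> conj_mat U ` mat_commutant n A"
  proof
    fix b assume b: "b \<in> mat_commutant n (conj_mat U ` A)"
    then have bc: "b \<in> carrier_mat n n" by (simp add: mat_commutant_def)
    have "a * conj_mat (mat_adjoint U) b = conj_mat (mat_adjoint U) b * a" if "a \<in> A" for a
    proof -
      have ac: "a \<in> carrier_mat n n" using A that by auto
      have "conj_mat U a * b = b * conj_mat U a" using b that by (auto simp: mat_commutant_def)
      then have "conj_mat (mat_adjoint U) (conj_mat U a) * conj_mat (mat_adjoint U) b
        = conj_mat (mat_adjoint U) b * conj_mat (mat_adjoint U) (conj_mat U a)"
        using U ac bc by (simp add: conj_mat_mult[OF V])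
      then show ?thesis using conj_mat_cancel[OF U ac] by simp
    qed
    then have "conj_mat (mat_adjoint U) b \<in> mat_commutant n A"
      using V bc by (auto simp: mat_commutant_def)
    then show "b \<in> conj_mat U ` mat_commutant n A" using conj_mat_cancel'[OF U bc] by force
  qed
  show "conj_mat U ` mat_commutant n A \<subseteq> mat_commutant n (conj_mat U ` A)"
    using U A by (auto simp: mat_commutant_def conj_mat_mult[OF U] subset_iff)
qed

section \<open>Decompositions of the multiplier algebra\<close>

lemma dim_mat_unit [simp]: "dim_row (mat_unit nr nc x y) = nr" "dim_col (mat_unit nr nc x y) = nc"
  by (simp_all add: mat_unit_def)

text \<open>The coordinate projection on the right-hand side of \<open>blocks_indexed_by\<close>.
  Multiplying by it on the left or right erases the rows or columns outside
  \<open>W\<close>.\<close>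

definition indicator_mat :: "nat \<Rightarrow> nat set \<Rightarrow> complex mat" where
  "indicator_mat n W = mat n n (\<lambda>(x, y). if x = y \<and> x \<in> W then 1 else 0)"

lemma indicator_mat_carrier [simp]: "indicator_mat n W \<in> carrier_mat n n"
  by (simp add: indicator_mat_def)

lemma dim_indicator_mat [simp]: "dim_row (indicator_mat n W) = n" "dim_col (indicator_mat n W) = n"
  by (simp_all add: indicator_mat_def)

lemma indicator_mat_index [simp]:
  "x < n \<Longrightarrow> y < n \<Longrightarrow> indicator_mat n W $$ (x, y) = (if x = y \<and> x \<in> W then 1 else 0)"
  by (simp add: indicator_mat_def)

lemma indicator_mat_times_index:
  assumes "A \<in> carrier_mat n n" "x < n" "y < n"
  shows "(indicator_mat n W * A) $$ (x, y) = (if x \<in> W then A $$ (x, y) else 0)"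
  using assms by (subst diagonal_times_index[where n = n and l = n]) auto

lemma times_indicator_mat_index:
  assumes "A \<in> carrier_mat n n" "x < n" "y < n"
  shows "(A * indicator_mat n W) $$ (x, y) = (if y \<in> W then A $$ (x, y) else 0)"
  using assms by (subst times_diagonal_index[where n = n and l = n]) auto

lemma indicator_mat_mult: "indicator_mat n W * indicator_mat n W' = indicator_mat n (W \<inter> W')"
  by (rule eq_matI) (auto simp: indicator_mat_times_index simp del: index_mult_mat(1))

lemma block_proj_eq_indicator_mat:
  assumes "block_start d k = n" "i < k"
  shows "block_proj n d i = indicator_mat n {r. block_of d r = i}"
proof (rule eq_matI)
  fix r s assume "r < dim_row (indicator_mat n {r. block_of d r = i})"
    "s < dim_col (indicator_mat n {r. block_of d r = i})"
  then have rs: "r < n" "s < n" by (auto simp: indicator_mat_def)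
  have "block_start d i \<le> r \<and> r < block_start d (Suc i) \<longleftrightarrow> block_of d r = i"
    using block_of_eqI[of d i r] block_of_bounds[of r d k] rs assms by auto
  then show "block_proj n d i $$ (r, s) = indicator_mat n {r. block_of d r = i} $$ (r, s)"
    using rs by (simp add: block_proj_def)
qed (auto simp: block_proj_def indicator_mat_def)

text \<open>The commutant of \<open>\<Oplus>\<^sub>i (M\<^bsub>\<alpha> i\<^esub> \<otimes> I\<^bsub>m i\<^esub>)\<close> contains a nonzero element of square zero as
  soon as some \<open>m i > 1\<close>, so it is not unitarily equivalent to an algebra of diagonal matrices.\<close>

lemma nilpotent_in_commutant:
  fixes \<alpha> m :: "nat \<Rightarrow> nat" and k :: nat
  defines "d \<equiv> \<lambda>i. \<alpha> i * m i"
  assumes "i < k" "0 < \<alpha> i" "1 < m i"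
  obtains N where
    "N \<in> mat_commutant (block_start d k)
       {diag_block_mat (map (\<lambda>i. kron (c i) (1\<^sub>m (m i))) [0..<k]) | c.
          \<forall>i<k. c i \<in> carrier_mat (\<alpha> i) (\<alpha> i)}"
    "N * N = 0\<^sub>m (block_start d k) (block_start d k)"
    "N \<noteq> 0\<^sub>m (block_start d k) (block_start d k)"
proof
  \<comment> \<open>The second tensor leg of summand \<open>i\<close> has room for the nilpotent
    \<epsilon>_01 because \<open>1 < m i\<close>; placed there, it commutes with everything acting
    on the first leg.\<close>
  define e where "e j = (if j = i then mat_unit (m j) (m j) 0 1 else 0\<^sub>m (m j) (m j))" for j
  define b where "b j = kron (1\<^sub>m (\<alpha> j)) (e j)" for j
  let ?n = "block_start d k"
  let ?N = "diag_block_mat (map b [0..<k])"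
  have e: "e j \<in> carrier_mat (m j) (m j)" for j by (simp add: e_def)
  have b: "b j \<in> carrier_mat (d j) (d j)" for j
    unfolding b_def d_def by (rule kron_carrier) (auto simp: e)
  have N: "?N \<in> carrier_mat ?n ?n" using b by (rule diag_block_mat_carrier)
  have "a * ?N = ?N * a"
    if c: "\<forall>i<k. c i \<in> carrier_mat (\<alpha> i) (\<alpha> i)"
      and a: "a = diag_block_mat (map (\<lambda>i. kron (c i) (1\<^sub>m (m i))) [0..<k])" for a c
  proof -
    have "kron (c j) (1\<^sub>m (m j)) \<in> carrier_mat (d j) (d j)" if "j < k" for j
      unfolding d_def using c that by (intro kron_carrier) auto
    moreover have "kron (c j) (1\<^sub>m (m j)) * b j = b j * kron (c j) (1\<^sub>m (m j))" if "j < k" for j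
      unfolding b_def
      using c e[of j] that by (subst kron_mult, auto)+
    ultimately show ?thesis
      using b unfolding a
      by (subst (1 2) diag_block_mat_mult[where d = d]) (auto intro!: arg_cong[where f = diag_block_mat])
  qed
  then show "?N \<in> mat_commutant ?n
       {diag_block_mat (map (\<lambda>i. kron (c i) (1\<^sub>m (m i))) [0..<k]) | c.
          \<forall>i<k. c i \<in> carrier_mat (\<alpha> i) (\<alpha> i)}"
    using N by (auto simp: mat_commutant_def)
  have "e j * e j = 0\<^sub>m (m j) (m j)" for j
  proof (cases "j = i")
    case True
    then show ?thesis
      using assms(4) mat_unit_carrier[of "m i" "m i" 0 1]
      by (intro eq_matI) (auto simp: e_def times_mat_unit_index simp del: index_mult_mat(1))
  qed (simp add: e_def)
  then have bb: "b j * b j = 0\<^sub>m (d j) (d j)" for j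
    unfolding b_def
    by (subst kron_mult[where p = "\<alpha> j" and r = "m j"])
      (use e[of j] in \<open>auto simp: kron_zero_right d_def\<close>)
  have NN: "?N * ?N = diag_block_mat (map (\<lambda>j. 0\<^sub>m (d j) (d j)) [0..<k])"
    using b by (subst diag_block_mat_mult[where d = d]) (auto simp: bb)
  show "?N * ?N = 0\<^sub>m ?n ?n"
    unfolding NN
    by (rule block_eq_matI[where d = d and k = k])
      (auto simp: diag_block_mat_index block_start_add_less intro!: diag_block_mat_carrier)
  have lt: "0 < d i" "1 < d i" using assms(2-4) by (auto simp: d_def less_le_trans)
  \<comment> \<open>Coordinates 0 and 1 of summand \<open>i\<close> share the index 0 in the first
    leg and differ in the second, so this entry is that of \<epsilon>_01.\<close>
  have "?N $$ (block_start d i + 0, block_start d i + 1) = b i $$ (0, 1)"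
    using b assms(2) lt by (subst diag_block_mat_index) auto
  also have "\<dots> = 1"
    using lt assms(2-4) by (simp add: b_def kron_def e_def d_def)
  finally show "?N \<noteq> 0\<^sub>m ?n ?n"
    using block_start_add_less[of i k 0 d] block_start_add_less[of i k 1 d] assms(2) lt by auto
qed

lemma diagonal_square_zero:
  assumes Z: "Z \<in> pattern_space n (=)" and sq: "Z * Z = 0\<^sub>m n n"
  shows "Z = 0\<^sub>m n n"
proof (rule eq_matI)
  fix x y assume "x < dim_row (0\<^sub>m n n :: complex mat)" "y < dim_col (0\<^sub>m n n :: complex mat)"
  then have xy: "x < n" "y < n" by auto
  have "(Z * Z) $$ (x, y) = Z $$ (x, x) * Z $$ (x, y)"
    using Z xy by (intro diagonal_times_index) (auto simp: pattern_space_def)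
  then have "Z $$ (x, x) * Z $$ (x, y) = 0" using sq xy by simp
  then show "Z $$ (x, y) = 0\<^sub>m n n $$ (x, y)"
    using Z xy by (cases "x = y") (auto simp: pattern_space_def)
qed (use Z in \<open>auto dest: pattern_space_carrier\<close>)

text \<open>The nilpotent is pulled back through \<open>U\<close> to the original coordinates, where
  the commutant is visibly diagonal; there square zero forces every entry to vanish.\<close>

lemma multiplicity_one:
  fixes \<alpha> m :: "nat \<Rightarrow> nat"
  assumes refl: "\<And>x. x < n \<Longrightarrow> E x x" and U: "unitary_mat n U"
    and pos: "\<And>i. i < k \<Longrightarrow> 0 < \<alpha> i \<and> 0 < m i" and n: "block_start (\<lambda>i. \<alpha> i * m i) k = n"
    and conj: "conj_mat U ` pattern_space n E =
      {diag_block_mat (map (\<lambda>i. kron (c i) (1\<^sub>m (m i))) [0..<k]) | c.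
        \<forall>i<k. c i \<in> carrier_mat (\<alpha> i) (\<alpha> i)}"
    and i: "i < k"
  shows "m i = 1"
proof (rule ccontr)
  assume "m i \<noteq> 1"
  then have "1 < m i" using pos[OF i] by simp
  obtain N where N: "N \<in> mat_commutant n (conj_mat U ` pattern_space n E)"
    and NN: "N * N = 0\<^sub>m n n" and nz: "N \<noteq> 0\<^sub>m n n"
    by (rule nilpotent_in_commutant[of i k \<alpha> m, unfolded n, folded conj]) (use pos[OF i] i \<open>1 < m i\<close> in auto)
  have "pattern_space n E \<subseteq> carrier_mat n n" by (auto dest: pattern_space_carrier)
  with N obtain Z where Z: "Z \<in> mat_commutant n (pattern_space n E)" and NZ: "N = conj_mat U Z"
    by (auto simp: commutant_conj_mat[OF U])
  have Zd: "Z \<in> pattern_space n (=)" using Z commutant_pattern_space[of n E] refl by auto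
  then have Zc: "Z \<in> carrier_mat n n" by (rule pattern_space_carrier)
  have "Z * Z = conj_mat (mat_adjoint U) (N * N)"
    using U Zc by (simp add: NZ conj_mat_mult conj_mat_cancel)
  also have "\<dots> = 0\<^sub>m n n" using NN conj_mat_zero[OF unitary_mat_adjoint[OF U]] by simp
  finally have "Z = 0\<^sub>m n n" using diagonal_square_zero[OF Zd] by simp
  then show False using nz NZ conj_mat_zero[OF U] by simp
qed

text \<open>Tensoring with a 1-by-1 identity changes nothing, so the summands become full matrix
  algebras. The sizes stay written as products to match the layout in the definition of a
  decomposition.\<close>

lemma decomposition_multiplicity_one:
  fixes \<alpha> m :: "nat \<Rightarrow> nat"
  assumes "\<And>i. i < k \<Longrightarrow> m i = 1"
  shows "{diag_block_mat (map (\<lambda>i. kron (c i) (1\<^sub>m (m i))) [0..<k]) | c.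
        \<forall>i<k. c i \<in> carrier_mat (\<alpha> i) (\<alpha> i)}
    = pattern_space (block_start (\<lambda>i. \<alpha> i * m i) k) (same_block (\<lambda>i. \<alpha> i * m i))"
proof -
  have "map (\<lambda>i. kron (c i) (1\<^sub>m (m i))) [0..<k] = map c [0..<k]" for c
    by (rule map_cong) (auto simp: assms kron_one_right)
  moreover have "(\<forall>i<k. c i \<in> carrier_mat (\<alpha> i) (\<alpha> i)) \<longleftrightarrow>
      (\<forall>i<k. c i \<in> carrier_mat (\<alpha> i * m i) (\<alpha> i * m i))" for c :: "nat \<Rightarrow> complex mat"
    using assms by simp
  ultimately show ?thesis
    unfolding block_diagonal_matrices_eq[symmetric] by presburger
qed

text \<open>Conjugation by \<open>U\<close> identifies two commutants that consist of diagonal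
  matrices: those constant on \<open>E\<close>-classes and those constant on blocks. Minimality is
  handled by hand. Block projections pull back to indicators of disjoint nonempty sets
  \<open>W i\<close>, each a union of classes; each class indicator, pushed forward, dominates some
  block projection. Hence some \<open>W i\<close> lies inside each class and must equal it.\<close>

lemma central_projections:
  fixes d :: "nat \<Rightarrow> nat"
  assumes refl: "\<And>x. x < n \<Longrightarrow> E x x" and sym: "\<And>x y. E x y \<Longrightarrow> E y x"
    and trans: "\<And>x y z. E x y \<Longrightarrow> E y z \<Longrightarrow> E x z"
    and U: "unitary_mat n U" and pos: "\<And>i. i < k \<Longrightarrow> 0 < d i" and n: "block_start d k = n"
    and conj: "conj_mat U ` pattern_space n E = pattern_space n (same_block d)"
  obtains W where "bij_betw W {0..<k} ((\<lambda>x. {y\<in>{0..<n}. E x y}) ` {0..<n})"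
    "\<And>i. i < k \<Longrightarrow> conj_mat (mat_adjoint U) (block_proj n d i) = indicator_mat n (W i)"
proof -
  let ?V = "mat_adjoint U"
  let ?ZE = "mat_commutant n (pattern_space n E)"
  let ?ZF = "mat_commutant n (pattern_space n (same_block d))"
  have V: "unitary_mat n ?V" using U by (rule unitary_mat_adjoint)
  have "pattern_space n E \<subseteq> carrier_mat n n" by (auto dest: pattern_space_carrier)
  then have ZF: "?ZF = conj_mat U ` ?ZE" using commutant_conj_mat[OF U] conj by metis
  have ZE_iff: "?ZE = {Z \<in> pattern_space n (=). \<forall>x<n. \<forall>y<n. E x y \<longrightarrow> Z $$ (x, x) = Z $$ (y, y)}"
    by (rule commutant_pattern_space) (rule refl)
  have ZF_iff: "?ZF = {Z \<in> pattern_space n (=).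
      \<forall>x<n. \<forall>y<n. same_block d x y \<longrightarrow> Z $$ (x, x) = Z $$ (y, y)}"
    by (rule commutant_pattern_space) simp
  define p where "p i = indicator_mat n {r. block_of d r = i}" for i
  define q where "q i = conj_mat ?V (p i)" for i
  define W where "W i = {x\<in>{0..<n}. q i $$ (x, x) = 1}" for i
  have p: "p i \<in> carrier_mat n n" for i by (simp add: p_def)
  have qc: "q i \<in> carrier_mat n n" for i using V p by (simp add: q_def)
  have pq: "p i = conj_mat U (q i)" for i using conj_mat_cancel'[OF U p] by (simp add: q_def)
  have qZ: "q i \<in> ?ZE" for i
  proof -
    have "p i \<in> ?ZF" unfolding ZF_iff by (auto simp: p_def pattern_space_def)
    then obtain Z where "Z \<in> ?ZE" "p i = conj_mat U Z" unfolding ZF by auto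
    then show ?thesis using conj_mat_cancel[OF U] unfolding q_def
      by (metis (no_types, lifting) mat_commutant_def mem_Collect_eq)
  qed
  have pp: "p i * p j = (if i = j then p i else 0\<^sub>m n n)" for i j
    unfolding p_def indicator_mat_mult by (rule eq_matI) (auto simp: indicator_mat_def)
  have qq: "q i * q j = (if i = j then q i else 0\<^sub>m n n)" for i j
    using conj_mat_mult[OF V p p, of i j] conj_mat_zero[OF V] by (simp add: q_def pp)
  have qdiag: "q i $$ (x, y) = 0" if "x < n" "y < n" "x \<noteq> y" for i x y
    using qZ[of i] that unfolding ZE_iff by (auto simp: pattern_space_def)
  have qq_index: "(q i * q j) $$ (x, x) = q i $$ (x, x) * q j $$ (x, x)" if "x < n" for i j x
    by (rule diagonal_times_index[OF qc qdiag qc that that])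
  \<comment> \<open>The diagonal entries of a diagonal idempotent solve t * t = t.\<close>
  have q01: "q i $$ (x, x) = (if x \<in> W i then 1 else 0)" if "x < n" for i x
    using qq_index[OF that, of i i] that by (auto simp: qq W_def)
  have q_ind: "q i = indicator_mat n (W i)" for i
  proof (rule eq_matI)
    fix x y assume "x < dim_row (indicator_mat n (W i))" "y < dim_col (indicator_mat n (W i))"
    then show "q i $$ (x, y) = indicator_mat n (W i) $$ (x, y)"
      by (cases "x = y") (auto simp: q01 qdiag)
  qed (use qc[of i] in auto)
  have disjoint: "i = j" if "x \<in> W i" "x \<in> W j" for x i j
    using qq_index[of x i j] that qq[of i j] by (auto simp: W_def split: if_splits)
  \<comment> \<open>A nonempty block has a nonzero projection, and conjugation cannot turn a nonzero
    matrix into zero.\<close>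
  have nonempty: "W i \<noteq> {}" if i: "i < k" for i
  proof
    assume "W i = {}"
    then have "q i = 0\<^sub>m n n" using qc[of i] q_ind[of i] by (intro eq_matI) auto
    then have "p i = 0\<^sub>m n n" using pq[of i] conj_mat_zero[OF U] by simp
    moreover have b: "block_start d i < n"
      using block_start_add_less[of i k 0 d] i pos[OF i] n by simp
    moreover have "block_of d (block_start d i) = i" using block_of_add[of 0 d i] pos[OF i] by simp
    then have "p i $$ (block_start d i, block_start d i) = 1" using b by (simp add: p_def)
    ultimately show False by simp
  qed
  have closed: "y \<in> W i" if "x \<in> W i" "y < n" "E x y" for i x y
    using qZ[of i] that unfolding ZE_iff by (auto simp: W_def)
  have hit: "\<exists>i<k. W i = {y\<in>{0..<n}. E x y}" if x: "x < n" for x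
  proof -
    let ?C = "{y\<in>{0..<n}. E x y}"
    define e where "e = indicator_mat n ?C"
    have ec: "e \<in> carrier_mat n n" by (simp add: e_def)
    have "y \<in> ?C \<longleftrightarrow> z \<in> ?C" if "y < n" "z < n" "E y z" for y z
      using that trans[of x y z] trans[of x z y] sym[of y z] by auto
    then have "e \<in> ?ZE" unfolding ZE_iff by (simp add: e_def pattern_space_def)
    then have f: "conj_mat U e \<in> ?ZF" unfolding ZF by blast
    have fc: "conj_mat U e \<in> carrier_mat n n" using U ec by simp
    have fnz: "conj_mat U e \<noteq> 0\<^sub>m n n"
    proof
      assume "conj_mat U e = 0\<^sub>m n n"
      then have "e = 0\<^sub>m n n" using conj_mat_cancel[OF U ec] conj_mat_zero[OF V] by simp
      moreover have "e $$ (x, x) = 1" using x refl[OF x] by (simp add: e_def)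
      ultimately show False using x by simp
    qed
    have fd: "conj_mat U e $$ (r, s) = 0" if "r < n" "s < n" "r \<noteq> s" for r s
      using f that unfolding ZF_iff by (auto dest: pattern_space_zero)
    have fs: "conj_mat U e $$ (r, r) = conj_mat U e $$ (s, s)" if "r < n" "s < n" "same_block d r s" for r s
      using f that unfolding ZF_iff by blast
    \<comment> \<open>The image of the class indicator is diagonal and nonzero. Any block where its
      diagonal does not vanish will do: being idempotent and constant on blocks, it equals 1
      throughout that block.\<close>
    have "\<exists>r<n. conj_mat U e $$ (r, r) \<noteq> 0"
    proof (rule ccontr)
      assume "\<not> (\<exists>r<n. conj_mat U e $$ (r, r) \<noteq> 0)"
      then have z: "conj_mat U e $$ (r, r) = 0" if "r < n" for r using that by blast
      have "conj_mat U e = 0\<^sub>m n n"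
      proof (rule eq_matI)
        fix s t assume "s < dim_row (0\<^sub>m n n :: complex mat)" "t < dim_col (0\<^sub>m n n :: complex mat)"
        then show "conj_mat U e $$ (s, t) = 0\<^sub>m n n $$ (s, t)"
          using z fd by (cases "s = t") auto
      qed (use fc in auto)
      then show False using fnz by simp
    qed
    then obtain r where r: "r < n" "conj_mat U e $$ (r, r) \<noteq> 0" by blast
    define i where "i = block_of d r"
    have i: "i < k" unfolding i_def by (rule block_of_bounds) (use r n in simp)
    have "e * e = e" by (simp add: e_def indicator_mat_mult)
    then have "conj_mat U e * conj_mat U e = conj_mat U e" using conj_mat_mult[OF U ec ec] by simp
    moreover have "(conj_mat U e * conj_mat U e) $$ (r, r) = conj_mat U e $$ (r, r) * conj_mat U e $$ (r, r)"
      by (rule diagonal_times_index[OF fc fd fc r(1) r(1)])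
    ultimately have "conj_mat U e $$ (r, r) = 1" using r(2) by simp
    then have one: "conj_mat U e $$ (s, s) = 1" if "s < n" "block_of d s = i" for s
      using fs[OF r(1) that(1)] that(2) by (simp add: i_def)
    \<comment> \<open>The pushed-forward class projection dominates the block projection; pulled
      back, this says that \<open>W i\<close> is contained in the class.\<close>
    have "p i * conj_mat U e = p i"
    proof (rule eq_matI)
      fix s t assume "s < dim_row (p i)" "t < dim_col (p i)"
      then have st: "s < n" "t < n" using p[of i] by auto
      then show "(p i * conj_mat U e) $$ (s, t) = p i $$ (s, t)"
        using one[of s] fd[of s t] fc
        by (auto simp: p_def indicator_mat_times_index simp del: index_mult_mat(1))
    qed (use p[of i] fc in auto)
    then have qe: "q i * e = q i"
      using conj_mat_mult[OF V p fc, of i] conj_mat_cancel[OF U ec] by (simp add: q_def)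
    have sub: "W i \<subseteq> ?C"
    proof
      fix z assume z: "z \<in> W i"
      then have zn: "z < n" by (simp add: W_def)
      then have "(q i * e) $$ (z, z) = (if z \<in> ?C then q i $$ (z, z) else 0)"
        unfolding e_def by (intro times_indicator_mat_index[OF qc])
      then show "z \<in> ?C" using z q01[OF zn, of i] by (simp add: qe split: if_splits)
    qed
    moreover have "?C \<subseteq> W i"
    proof
      fix z assume "z \<in> ?C"
      obtain y where y: "y \<in> W i" using nonempty[OF i] by blast
      then have "E x y" using sub by auto
      then have "E y z" using \<open>z \<in> ?C\<close> sym trans by blast
      then show "z \<in> W i" using closed[OF y] \<open>z \<in> ?C\<close> by simp
    qed
    ultimately show ?thesis using i by blast
  qed
  \<comment> \<open>The class of a point of \<open>W i\<close> is some \<open>W j\<close>, and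
    disjointness gives \<open>j = i\<close>.\<close>
  have cls: "W i \<in> (\<lambda>x. {y\<in>{0..<n}. E x y}) ` {0..<n}" if i: "i < k" for i
  proof -
    obtain x where x: "x \<in> W i" using nonempty[OF i] by blast
    then have xn: "x < n" by (simp add: W_def)
    then obtain j where "W j = {y\<in>{0..<n}. E x y}" using hit by blast
    moreover from this have "j = i" using disjoint[of x j i] x xn refl by simp
    ultimately show ?thesis using xn by auto
  qed
  have "inj_on W {0..<k}"
    using disjoint nonempty by (intro inj_onI) (metis atLeastLessThan_iff ex_in_conv)
  moreover have "W ` {0..<k} = (\<lambda>x. {y\<in>{0..<n}. E x y}) ` {0..<n}"
  proof
    show "W ` {0..<k} \<subseteq> (\<lambda>x. {y\<in>{0..<n}. E x y}) ` {0..<n}" using cls by auto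
    show "(\<lambda>x. {y\<in>{0..<n}. E x y}) ` {0..<n} \<subseteq> W ` {0..<k}"
    proof (rule image_subsetI)
      fix x assume "x \<in> {0..<n}"
      then obtain i where "i < k" "W i = {y\<in>{0..<n}. E x y}" using hit by auto
      then show "{y\<in>{0..<n}. E x y} \<in> W ` {0..<k}" by force
    qed
  qed
  ultimately have "bij_betw W {0..<k} ((\<lambda>x. {y\<in>{0..<n}. E x y}) ` {0..<n})"
    by (simp add: bij_betw_def)
  moreover have "conj_mat ?V (block_proj n d i) = indicator_mat n (W i)" if "i < k" for i
    using block_proj_eq_indicator_mat[OF n that] q_ind[of i] by (simp add: q_def p_def)
  ultimately show thesis by (rule that)
qed

section \<open>The skeleton\<close>

lemma block_start_ones:
  assumes "\<And>i. i < k \<Longrightarrow> m i = Suc 0" "i \<le> k"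
  shows "block_start m i = i"
  using assms(2)
proof (induction i)
  case (Suc i)
  then show ?case using assms(1) by (simp add: block_start_Suc)
qed (simp add: block_start_def)

lemma block_of_ones:
  assumes "\<And>i. i < k \<Longrightarrow> m i = Suc 0" "i < k"
  shows "block_of m i = i"
  using assms block_start_ones[of k m i] block_start_ones[of k m "Suc i"]
  by (intro block_of_eqI) auto

text \<open>The slice sees only the corner entry of a block, and compressing by the two block
  projections leaves that entry unchanged. In the original coordinates the compression restricts a
  matrix to the rectangle \<open>W i\<close> by \<open>W j\<close>, on which \<open>P\<close> is
  constantly \<open>Q i j\<close>. So either every compressed matrix vanishes, or the operator
  system contains every matrix supported on that rectangle.\<close>

lemma skeleton_wrt_pattern_space:
  fixes \<alpha> m :: "nat \<Rightarrow> nat"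
  defines "d \<equiv> \<lambda>i. \<alpha> i * m i"
  assumes m: "\<And>i. i < k \<Longrightarrow> m i = Suc 0" and \<alpha>: "\<And>i. i < k \<Longrightarrow> 0 < \<alpha> i"
    and n: "block_start d k = n" and U: "unitary_mat n U"
    and W: "\<And>i. i < k \<Longrightarrow> conj_mat (mat_adjoint U) (block_proj n d i) = indicator_mat n (W i)"
    and rel: "\<And>i j x y. i < k \<Longrightarrow> j < k \<Longrightarrow> x \<in> W i \<Longrightarrow> y \<in> W j \<Longrightarrow> P x y \<longleftrightarrow> Q i j"
  shows "skeleton_wrt (pattern_space n P) (k, \<alpha>, m, U) = (k, pattern_space k Q, diagonal_algebra k)"
proof -
  let ?V = "mat_adjoint U"
  let ?b = "block_start d"
  let ?p = "block_proj n d"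
  have V: "unitary_mat n ?V" using U by (rule unitary_mat_adjoint)
  have N: "(\<Sum>i<k. m i) = k" using m by simp
  have lt: "?b i < n" if "i < k" for i
    using block_start_add_less[of i k 0 d] that m \<alpha> n by (simp add: d_def)
  have p: "?p i = indicator_mat n {r. block_of d r = i}" if "i < k" for i
    using n that by (rule block_proj_eq_indicator_mat)
  have bo: "block_of d (?b i) = i" if "i < k" for i
    using block_of_add[of 0 d i] that m \<alpha> by (simp add: d_def)
  have corner: "(?p i * Y * ?p j) $$ (?b i, ?b j) = Y $$ (?b i, ?b j)"
    if "Y \<in> carrier_mat n n" "i < k" "j < k" for Y i j
  proof -
    have "indicator_mat n {r. block_of d r = i} * Y \<in> carrier_mat n n"
      using that by (intro mult_carrier_mat[of _ n n]) auto
    then show ?thesis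
      using that lt[of i] lt[of j]
      by (simp add: p bo times_indicator_mat_index indicator_mat_times_index del: index_mult_mat(1))
  qed
  have compress: "conj_mat ?V (?p i * Y * ?p j) = indicator_mat n (W i) * conj_mat ?V Y * indicator_mat n (W j)"
    if "Y \<in> carrier_mat n n" "i < k" "j < k" for Y i j
  proof -
    have "?p i * Y \<in> carrier_mat n n" using that by (auto simp: p)
    then show ?thesis
      using that conj_mat_mult[OF V, of "?p i" Y] conj_mat_mult[OF V, of "?p i * Y" "?p j"]
      by (simp add: p W[symmetric])
  qed
  \<comment> \<open>Pairing with the (1,1) unit leaves the single term with both first-leg indices
    0, which sits at the start of both blocks; those positions exist since \<open>\<alpha> i\<close>
    and \<open>\<alpha> j\<close> are positive.\<close>
  have slice: "slice (m i) (m j) (mat_unit (\<alpha> j) (\<alpha> i) 0 0) (mat_block d i j Y)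
      = mat 1 1 (\<lambda>_. Y $$ (?b i, ?b j))" if "i < k" "j < k" for i j Y
  proof -
    have "(\<Sum>a<\<alpha> i. \<Sum>a'<\<alpha> j. mat_unit (\<alpha> j) (\<alpha> i) 0 0 $$ (a', a) * mat_block d i j Y $$ (a, a'))
      = (\<Sum>a<\<alpha> i. \<Sum>a'<\<alpha> j. if a' = 0 then (if a = 0 then Y $$ (?b i, ?b j) else 0) else 0)"
      using that m \<alpha> by (intro sum.cong) (auto simp: mat_block_def d_def)
    also have "\<dots> = Y $$ (?b i, ?b j)" using that \<alpha> by (simp add: sum.delta)
    finally show ?thesis using that m by (intro eq_matI) (auto simp: slice_def)
  qed
  have R: "R_block (pattern_space n P) (k, \<alpha>, m, U) i j
      = {mat 1 1 (\<lambda>_. conj_mat U s $$ (?b i, ?b j)) | s. s \<in> pattern_space n P}"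
    if "i < k" "j < k" for i j
    unfolding R_block_def S_block_def prod.case d_def[symmetric] conj_mat_def[symmetric]
      Setcompr_eq_image image_image slice[OF that] ..
  have attained: "c = 0 \<or> Q i j \<longleftrightarrow> (\<exists>s\<in>pattern_space n P. conj_mat U s $$ (?b i, ?b j) = c)"
    if ij: "i < k" "j < k" for i j c
  proof
    assume c: "c = 0 \<or> Q i j"
    \<comment> \<open>The target is chosen in the decomposed coordinates and pulled back. Its
      preimage may have many nonzero entries, but all lie in the rectangle \<open>W i\<close> by
      \<open>W j\<close>, because \<open>Y\<close> is fixed by the compression.\<close>
    define Y where "Y = c \<cdot>\<^sub>m mat_unit n n (?b i) (?b j)"
    have Yc: "Y \<in> carrier_mat n n" by (simp add: Y_def)
    have Yv: "Y $$ (?b i, ?b j) = c" using lt ij by (simp add: Y_def)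
    have pYp: "?p i * Y * ?p j = Y"
    proof (rule eq_matI)
      fix r s assume "r < dim_row Y" "s < dim_col Y"
      then have rs: "r < n" "s < n" using Yc by auto
      have "indicator_mat n {r. block_of d r = i} * Y \<in> carrier_mat n n"
        using Yc by (intro mult_carrier_mat[of _ n n]) auto
      then show "(?p i * Y * ?p j) $$ (r, s) = Y $$ (r, s)"
        using rs Yc ij bo
        by (auto simp: p times_indicator_mat_index indicator_mat_times_index Y_def simp del: index_mult_mat(1))
    qed (use ij Yc in \<open>auto simp: p\<close>)
    define s where "s = conj_mat ?V Y"
    have sc: "s \<in> carrier_mat n n" using V Yc by (simp add: s_def)
    have s: "s = indicator_mat n (W i) * s * indicator_mat n (W j)"
      using compress[OF Yc ij] by (simp add: pYp s_def)
    have "s $$ (x, y) = 0" if "x < n" "y < n" "\<not> P x y" for x y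
    \<comment> \<open>The value 0 is attained even when \<open>Q i j\<close> fails: the preimage is
      then the zero matrix, which fits every relation.\<close>
    proof (cases "c = 0")
      case True
      then have "Y = 0\<^sub>m n n" by (auto simp: Y_def)
      then show ?thesis using conj_mat_zero[OF V] that by (simp add: s_def)
    next
      case False
      then have "\<not> (x \<in> W i \<and> y \<in> W j)" using c rel[OF ij] that by blast
      moreover have "indicator_mat n (W i) * s \<in> carrier_mat n n"
        using sc by (intro mult_carrier_mat[of _ n n]) auto
      ultimately show ?thesis
        using that sc by (subst s)
          (auto simp: times_indicator_mat_index indicator_mat_times_index simp del: index_mult_mat(1))
    qed
    then have "s \<in> pattern_space n P" using sc by (auto simp: pattern_space_def)
    moreover have "conj_mat U s = Y" using conj_mat_cancel'[OF U Yc] by (simp add: s_def)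
    ultimately show "\<exists>s\<in>pattern_space n P. conj_mat U s $$ (?b i, ?b j) = c" using Yv by blast
  next
    assume "\<exists>s\<in>pattern_space n P. conj_mat U s $$ (?b i, ?b j) = c"
    then obtain s where s: "s \<in> pattern_space n P" and c: "conj_mat U s $$ (?b i, ?b j) = c" by blast
    have sc: "s \<in> carrier_mat n n" using s by (rule pattern_space_carrier)
    then have Yc: "conj_mat U s \<in> carrier_mat n n" using U by simp
    show "c = 0 \<or> Q i j"
    proof (cases "Q i j")
      case False
      have isc: "indicator_mat n (W i) * s \<in> carrier_mat n n"
        using sc by (intro mult_carrier_mat[of _ n n]) auto
      have "indicator_mat n (W i) * s * indicator_mat n (W j) = 0\<^sub>m n n"
      proof (rule eq_matI)
        fix x y assume "x < dim_row (0\<^sub>m n n :: complex mat)" "y < dim_col (0\<^sub>m n n :: complex mat)"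
        then have xy: "x < n" "y < n" by auto
        then show "(indicator_mat n (W i) * s * indicator_mat n (W j)) $$ (x, y) = 0\<^sub>m n n $$ (x, y)"
          using False rel[OF ij] isc sc pattern_space_zero[OF s xy]
          by (auto simp: times_indicator_mat_index indicator_mat_times_index simp del: index_mult_mat(1))
      qed (use sc in auto)
      then have zero: "conj_mat ?V (?p i * conj_mat U s * ?p j) = 0\<^sub>m n n"
        using compress[OF Yc ij] conj_mat_cancel[OF U sc] by simp
      have "?p i * conj_mat U s * ?p j \<in> carrier_mat n n"
        using Yc ij by (intro mult_carrier_mat[of _ n n]) (auto simp: p)
      then have "?p i * conj_mat U s * ?p j = 0\<^sub>m n n"
        using conj_mat_cancel'[OF U] zero conj_mat_zero[OF U] by metis
      then show ?thesis using corner[OF Yc ij] c lt ij by simp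
    qed simp
  qed
  have mem: "mat_block m i j X \<in> R_block (pattern_space n P) (k, \<alpha>, m, U) i j
      \<longleftrightarrow> X $$ (i, j) = 0 \<or> Q i j" if ij: "i < k" "j < k" for i j X
  proof -
    have "mat_block m i j X = mat 1 1 (\<lambda>_. X $$ (i, j))"
      using ij m block_start_ones[of k m] by (intro eq_matI) (auto simp: mat_block_def)
    moreover have "mat 1 1 (\<lambda>_. a) = (mat 1 1 (\<lambda>_. b) :: complex mat) \<longleftrightarrow> a = b" for a b
      by (auto dest: arg_cong[where f = "\<lambda>M. M $$ (0, 0)"])
    ultimately show ?thesis
      unfolding R[OF ij] attained[OF ij, of "X $$ (i, j)"] by (auto; metis)
  qed
  have "{X \<in> carrier_mat k k. \<forall>i<k. \<forall>j<k. mat_block m i j X \<in> R_block (pattern_space n P) (k, \<alpha>, m, U) i j}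
      = pattern_space k Q"
    using mem by (auto simp: pattern_space_def)
  \<comment> \<open>With all blocks of size one, being in the same block is equality of
    indices.\<close>
  moreover have "{diag_block_mat (map c [0..<k]) | c. \<forall>i<k. c i \<in> carrier_mat (m i) (m i)} = diagonal_algebra k"
    unfolding block_diagonal_matrices_eq diagonal_algebra_eq_pattern_space
    using block_start_ones[of k m k] block_of_ones[of k m] m
    by (auto intro!: pattern_space_cong)
  ultimately show ?thesis by (simp add: skeleton_wrt_def N)
qed

section \<open>A decomposition for a prescribed numbering of the classes\<close>

text \<open>\<open>U\<close> sends the basis vector with index \<open>\<pi> r\<close> to the one
  with index \<open>r\<close>, so conjugation just re-indexes rows and columns by \<pi>.\<close>

lemma permutation_unitary:
  fixes \<pi> :: "nat \<Rightarrow> nat"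
  assumes \<pi>: "bij_betw \<pi> {0..<n} {0..<n}"
  defines "U \<equiv> mat n n (\<lambda>(r, x). if \<pi> r = x then 1 else 0)"
  shows "unitary_mat n U"
    and "\<And>X r s. X \<in> carrier_mat n n \<Longrightarrow> r < n \<Longrightarrow> s < n \<Longrightarrow> conj_mat U X $$ (r, s) = X $$ (\<pi> r, \<pi> s)"
proof -
  have Uc: "U \<in> carrier_mat n n" by (simp add: U_def)
  then have V: "mat_adjoint U \<in> carrier_mat n n" by simp
  have \<pi>n: "\<pi> r < n" if "r < n" for r using bij_betwE[OF \<pi>] that by auto
  have inj: "\<pi> r = \<pi> s \<longleftrightarrow> r = s" if "r < n" "s < n" for r s
    using bij_betw_imp_inj_on[OF \<pi>] that by (auto simp: inj_on_def)
  have left: "(U * X) $$ (r, s) = X $$ (\<pi> r, s)" if "X \<in> carrier_mat n n" "r < n" "s < n" for X r s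
  proof -
    have "(U * X) $$ (r, s) = (\<Sum>x<n. U $$ (r, x) * X $$ (x, s))"
      by (rule times_mat_index[OF Uc that])
    also have "\<dots> = (\<Sum>x<n. if x = \<pi> r then X $$ (\<pi> r, s) else 0)"
      using that by (intro sum.cong) (auto simp: U_def)
    finally show ?thesis using \<pi>n[OF that(2)] by (simp add: sum.delta)
  qed
  have right: "(X * mat_adjoint U) $$ (r, s) = X $$ (r, \<pi> s)" if "X \<in> carrier_mat n n" "r < n" "s < n" for X r s
  proof -
    have "(X * mat_adjoint U) $$ (r, s) = (\<Sum>x<n. X $$ (r, x) * mat_adjoint U $$ (x, s))"
      by (rule times_mat_index[OF that(1) V that(2,3)])
    also have "\<dots> = (\<Sum>x<n. if x = \<pi> s then X $$ (r, \<pi> s) else 0)"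
      using that by (intro sum.cong) (auto simp: U_def mat_adjoint_index)
    finally show ?thesis using \<pi>n[OF that(3)] by (simp add: sum.delta)
  qed
  have "U * mat_adjoint U = 1\<^sub>m n"
  proof (rule eq_matI)
    fix r s assume "r < dim_row (1\<^sub>m n :: complex mat)" "s < dim_col (1\<^sub>m n :: complex mat)"
    then have rs: "r < n" "s < n" by auto
    then show "(U * mat_adjoint U) $$ (r, s) = 1\<^sub>m n $$ (r, s)"
      using right[OF Uc rs] inj \<pi>n by (auto simp: U_def)
  qed (use Uc carrier_matD[OF V] in auto)
  then show "unitary_mat n U"
    using mat_mult_left_right_inverse[OF Uc V] Uc by (simp add: unitary_mat_def)
  show "conj_mat U X $$ (r, s) = X $$ (\<pi> r, \<pi> s)" if "X \<in> carrier_mat n n" "r < n" "s < n" for X r s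
  proof -
    have "U * X \<in> carrier_mat n n" using Uc that(1) by (rule mult_carrier_mat)
    then show ?thesis unfolding conj_mat_def using that right[of "U * X" r s] left[of X r "\<pi> s"] \<pi>n by simp
  qed
qed

text \<open>The classes are laid out one after another, each listed by a chosen bijection
  \<open>e i\<close>. Disjointness makes the combined listing injective, and an injective self-map
  of a finite set is onto.\<close>

lemma block_enumeration:
  assumes fin: "\<And>i. i < k \<Longrightarrow> finite (W i)" and un: "(\<Union>i<k. W i) = {0..<n}"
    and disj: "\<And>i j x. i < k \<Longrightarrow> j < k \<Longrightarrow> x \<in> W i \<Longrightarrow> x \<in> W j \<Longrightarrow> i = j"
  defines "d \<equiv> \<lambda>i. card (W i)"
  obtains \<pi> where "bij_betw \<pi> {0..<n} {0..<n}" "block_start d k = n"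
    "\<And>r. r < n \<Longrightarrow> \<pi> r \<in> W (block_of d r)"
proof -
  have "n = card (\<Union>i\<in>{..<k}. W i)" using un by simp
  also have "\<dots> = (\<Sum>i\<in>{..<k}. card (W i))"
    using fin disj by (intro card_UN_disjoint) auto
  finally have n: "block_start d k = n" by (simp add: block_start_def d_def)
  have "\<exists>e. bij_betw e {0..<d i} (W i)" if "i < k" for i
    using ex_bij_betw_nat_finite[OF fin[OF that]] by (simp add: d_def)
  then obtain e where e: "\<And>i. i < k \<Longrightarrow> bij_betw (e i) {0..<d i} (W i)" by metis
  define \<pi> where "\<pi> r = e (block_of d r) (r - block_start d (block_of d r))" for r
  have \<pi>: "\<pi> (block_start d i + a) = e i a" if "a < d i" for i a
    using that by (simp add: \<pi>_def)
  have eW: "e i a \<in> W i" if "i < k" "a < d i" for i a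
    using bij_betwE[OF e[OF that(1)]] that(2) by simp
  have mem: "\<pi> r \<in> W (block_of d r)" if "r < n" for r
    using that unfolding n[symmetric] by (elim block_decompE) (simp add: \<pi> eW)
  have "inj_on \<pi> {0..<n}"
  proof (rule inj_onI)
    fix r s assume rs: "r \<in> {0..<n}" "s \<in> {0..<n}" and eq: "\<pi> r = \<pi> s"
    obtain i a where r: "i < k" "a < d i" "r = block_start d i + a"
      using rs(1) n by (auto elim: block_decompE)
    obtain j b where s: "j < k" "b < d j" "s = block_start d j + b"
      using rs(2) n by (auto elim: block_decompE)
    have ee: "e i a = e j b" using eq r s by (simp add: \<pi>)
    then have "i = j" using disj[OF r(1) s(1) eW[OF r(1,2)]] eW[OF s(1,2)] by simp
    moreover from this have "a = b"
      using bij_betw_imp_inj_on[OF e[OF r(1)]] ee r(2) s(2) by (auto simp: inj_on_def)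
    ultimately show "r = s" using r s by simp
  qed
  moreover have "\<pi> ` {0..<n} \<subseteq> {0..<n}"
  proof (rule image_subsetI)
    fix r assume "r \<in> {0..<n}"
    then show "\<pi> r \<in> {0..<n}"
      using mem[of r] block_of_bounds(1)[of r d k] n un by auto
  qed
  ultimately have "bij_betw \<pi> {0..<n} {0..<n}"
    by (simp add: bij_betw_def endo_inj_surj)
  then show thesis using n mem by (rule that)
qed

text \<open>Reordering the basis so that each class is consecutive turns matrices supported on
  \<open>E\<close> into block-diagonal ones. The order of the classes is the one given by
  \<open>W\<close>, which places summand \<open>i\<close> on exactly the class
  \<open>W i\<close>.\<close>

lemma permutation_decomposition:
  assumes W: "bij_betw W {0..<k} ((\<lambda>x. {y\<in>{0..<n}. E x y}) ` {0..<n})"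
    and refl: "\<And>x. x < n \<Longrightarrow> E x x" and sym: "\<And>x y. E x y \<Longrightarrow> E y x"
    and trans: "\<And>x y z. E x y \<Longrightarrow> E y z \<Longrightarrow> E x z"
  defines "d \<equiv> \<lambda>i. card (W i)"
  obtains U where "unitary_mat n U" "block_start d k = n" "\<And>i. i < k \<Longrightarrow> 0 < d i"
    "conj_mat U ` pattern_space n E = pattern_space n (same_block d)"
    "\<And>i. i < k \<Longrightarrow> conj_mat (mat_adjoint U) (block_proj n d i) = indicator_mat n (W i)"
proof -
  have is_class: "\<exists>x<n. W i = {y\<in>{0..<n}. E x y}" if "i < k" for i
  proof -
    have "W i \<in> (\<lambda>x. {y\<in>{0..<n}. E x y}) ` {0..<n}" using bij_betwE[OF W] that by simp
    then show ?thesis by (elim imageE) auto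
  qed
  have sub: "W i \<subseteq> {0..<n}" if "i < k" for i using is_class[OF that] by blast
  have fin: "finite (W i)" if "i < k" for i using sub[OF that] by (rule finite_subset) simp
  have ne: "0 < d i" if i: "i < k" for i
  proof -
    obtain x where "x < n" "W i = {y\<in>{0..<n}. E x y}" using is_class[OF i] by blast
    then have "x \<in> W i" using refl by simp
    then show ?thesis using fin[OF i] by (auto simp: d_def card_gt_0_iff)
  qed
  have un: "(\<Union>i<k. W i) = {0..<n}"
  proof
    show "(\<Union>i<k. W i) \<subseteq> {0..<n}" using sub by auto
    show "{0..<n} \<subseteq> (\<Union>i<k. W i)"
    proof
      fix x assume x: "x \<in> {0..<n}"
      then have "{y\<in>{0..<n}. E x y} \<in> W ` {0..<k}" using bij_betw_imp_surj_on[OF W] by blast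
      then obtain i where "i < k" "W i = {y\<in>{0..<n}. E x y}" by auto
      then show "x \<in> (\<Union>i<k. W i)" using x refl by auto
    qed
  qed
  have E_iff: "E x y \<longleftrightarrow> i = j" if ij: "i < k" "j < k" and x: "x \<in> W i" and y: "y \<in> W j" for i j x y
  proof -
    obtain a where a: "W i = {y\<in>{0..<n}. E a y}" using is_class[OF ij(1)] by blast
    obtain b where b: "W j = {y\<in>{0..<n}. E b y}" using is_class[OF ij(2)] by blast
    have ax: "E a x" and bY: "E b y" using x y a b by auto
    show ?thesis
    proof
      assume "E x y"
      then have "E a b" using ax bY sym trans by blast
      then have "E a z \<longleftrightarrow> E b z" for z using sym trans by blast
      then have "W i = W j" unfolding a b by simp
      then show "i = j" using bij_betw_imp_inj_on[OF W] ij by (simp add: inj_on_def)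
    next
      assume "i = j"
      then have "E a y" using y a by simp
      then show "E x y" using ax sym trans by blast
    qed
  qed
  have disj: "i = j" if "i < k" "j < k" "x \<in> W i" "x \<in> W j" for i j x
    using E_iff[OF that] refl[of x] sub[OF that(1)] that(3) by auto
  obtain \<pi> where \<pi>: "bij_betw \<pi> {0..<n} {0..<n}" and n: "block_start d k = n"
    and mem: "\<And>r. r < n \<Longrightarrow> \<pi> r \<in> W (block_of d r)"
    by (rule block_enumeration[of k W n, folded d_def])
      (rule un | (rule fin; assumption) | (rule disj; assumption) | blast)+
  define U :: "complex mat" where "U = mat n n (\<lambda>(r, x). if \<pi> r = x then 1 else 0)"
  have U: "unitary_mat n U"
    and conj: "\<And>X r s. X \<in> carrier_mat n n \<Longrightarrow> r < n \<Longrightarrow> s < n \<Longrightarrow> conj_mat U X $$ (r, s) = X $$ (\<pi> r, \<pi> s)"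
    using permutation_unitary[OF \<pi>] unfolding U_def by blast+
  have V: "unitary_mat n (mat_adjoint U)" using U by (rule unitary_mat_adjoint)
  have blk: "block_of d r < k" if "r < n" for r by (rule block_of_bounds) (use that n in simp)
  have \<pi>n: "\<pi> r < n" if "r < n" for r using bij_betwE[OF \<pi>] that by auto
  have E_blk: "E (\<pi> r) (\<pi> s) \<longleftrightarrow> same_block d r s" if "r < n" "s < n" for r s
    using E_iff blk mem that by blast
  have surj: "\<exists>r<n. x = \<pi> r" if "x < n" for x
  proof -
    have "x \<in> \<pi> ` {0..<n}" using bij_betw_imp_surj_on[OF \<pi>] that by simp
    then show ?thesis by auto
  qed
  have "conj_mat U ` pattern_space n E = pattern_space n (same_block d)"
  proof
    show "conj_mat U ` pattern_space n E \<subseteq> pattern_space n (same_block d)"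
    proof (rule image_subsetI)
      fix X assume X: "X \<in> pattern_space n E"
      then have Xc: "X \<in> carrier_mat n n" by (rule pattern_space_carrier)
      then show "conj_mat U X \<in> pattern_space n (same_block d)"
        using X U unfolding pattern_space_def by (auto simp: conj E_blk[symmetric] \<pi>n)
    qed
    show "pattern_space n (same_block d) \<subseteq> conj_mat U ` pattern_space n E"
    proof
      fix Y assume Y: "Y \<in> pattern_space n (same_block d)"
      then have Yc: "Y \<in> carrier_mat n n" by (rule pattern_space_carrier)
      let ?X = "conj_mat (mat_adjoint U) Y"
      have Xc: "?X \<in> carrier_mat n n" using V Yc by simp
      \<comment> \<open>Only conjugation by \<open>U\<close> has an entry formula; surjectivity of
        \<pi> lets it be read backwards for the inverse conjugation.\<close>
      have "?X $$ (x, y) = 0" if xy: "x < n" "y < n" "\<not> E x y" for x y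
      proof -
        obtain r s where rs: "r < n" "s < n" "x = \<pi> r" "y = \<pi> s" using surj xy by metis
        have "?X $$ (x, y) = Y $$ (r, s)"
          using conj[OF Xc rs(1,2)] conj_mat_cancel'[OF U Yc] rs by simp
        also have "\<dots> = 0" using E_blk[OF rs(1,2)] xy rs by (intro pattern_space_zero[OF Y]) auto
        finally show ?thesis .
      qed
      then have "?X \<in> pattern_space n E" using Xc by (auto simp: pattern_space_def)
      then show "Y \<in> conj_mat U ` pattern_space n E" using conj_mat_cancel'[OF U Yc] by force
    qed
  qed
  moreover have "conj_mat (mat_adjoint U) (block_proj n d i) = indicator_mat n (W i)" if i: "i < k" for i
  proof -
    have "block_proj n d i = conj_mat U (indicator_mat n (W i))"
      unfolding block_proj_eq_indicator_mat[OF n i]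
    proof (rule eq_matI)
      fix r s assume "r < dim_row (conj_mat U (indicator_mat n (W i)))"
        "s < dim_col (conj_mat U (indicator_mat n (W i)))"
      moreover have "conj_mat U (indicator_mat n (W i)) \<in> carrier_mat n n" using U by simp
      ultimately have rs: "r < n" "s < n" by auto
      have "\<pi> r = \<pi> s \<longleftrightarrow> r = s"
        using bij_betw_imp_inj_on[OF \<pi>] rs by (auto simp: inj_on_def)
      moreover have "\<pi> r \<in> W i \<longleftrightarrow> block_of d r = i"
        using mem[OF rs(1)] disj[OF blk[OF rs(1)] i] by auto
      ultimately show "indicator_mat n {r. block_of d r = i} $$ (r, s) = conj_mat U (indicator_mat n (W i)) $$ (r, s)"
        using rs by (simp add: conj \<pi>n)
    qed (use carrier_matD[OF conj_mat_carrier[OF U indicator_mat_carrier[of n "W i"]]] in auto)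
    then show ?thesis using conj_mat_cancel[OF U] by simp
  qed
  ultimately show thesis using that U n ne by blast
qed

lemma blocks_indexed_by_iff:
  "blocks_indexed_by n (k, \<alpha>, m, U) v \<longleftrightarrow>
    (\<forall>i<k. conj_mat (mat_adjoint U) (block_proj n (\<lambda>l. \<alpha> l * m l) i) = indicator_mat n (v i))"
  by (simp add: blocks_indexed_by_def conj_mat_def indicator_mat_def)

lemma multiplier_decomposition_iff:
  "multiplier_decomposition n S (k, \<alpha>, m, U) \<longleftrightarrow>
     (\<forall>i<k. 0 < \<alpha> i \<and> 0 < m i) \<and> block_start (\<lambda>i. \<alpha> i * m i) k = n \<and> unitary_mat n U \<and>
     conj_mat U ` multiplier_algebra n S =
     {diag_block_mat (map (\<lambda>i. kron (c i) (1\<^sub>m (m i))) [0..<k]) | c.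
        \<forall>i<k. c i \<in> carrier_mat (\<alpha> i) (\<alpha> i)}"
  by (simp add: multiplier_decomposition_def block_start_def conj_mat_def Setcompr_eq_image)

section \<open>True twins and adjacency in the skeleton graph\<close>

text \<open>True twins, in the form in which the multiplier algebra produces the relation. As only
  \<open>z\<close> is bounded, it is an equivalence on all naturals, as the lemmas on projections
  and permutations require.\<close>

definition twins :: "nat pair_pre_digraph \<Rightarrow> nat \<Rightarrow> nat \<Rightarrow> nat \<Rightarrow> bool" where
  "twins G n x y \<longleftrightarrow> (\<forall>z<n. adj_eq G x z \<longleftrightarrow> adj_eq G y z)"

lemma twins_sym: "twins G n x y \<Longrightarrow> twins G n y x"
  and twins_trans: "twins G n x y \<Longrightarrow> twins G n y z \<Longrightarrow> twins G n x z"
  and twins_refl: "twins G n x x"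
  by (simp_all add: twins_def)

lemma twin_class_eq:
  assumes "pverts G = {0..<n}"
  shows "twin_class G x = {y\<in>{0..<n}. twins G n x y}"
  using assms by (auto simp: twin_class_def closed_nbhd_def twins_def set_eq_iff)

lemma adj_eq_sym:
  assumes "pair_graph G" "adj_eq G x y"
  shows "adj_eq G y x"
proof -
  interpret pair_graph G by fact
  show ?thesis using assms(2) arcs_symmetric by (auto simp: adj_eq_def)
qed

text \<open>Adjacency or equality depends only on the twin classes of the endpoints, so the
  witnesses of an edge between two classes can be exchanged for any chosen representatives. Within
  one class it always holds, as a twin of \<open>y\<close> is related to everything \<open>y\<close>
  is related to, including \<open>y\<close>.\<close>

lemma adj_eq_skeleton:
  fixes G :: "nat pair_pre_digraph"
  assumes G: "pair_graph G" "pverts G = {0..<n}" and v: "enumerates v k (graph_skeleton G)"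
    and ij: "i < k" "j < k" and x: "x \<in> v i" and y: "y \<in> v j"
  shows "adj_eq G x y \<longleftrightarrow> adj_eq (relabel v k (graph_skeleton G)) i j"
proof -
  interpret pair_graph G by fact
  have is_class: "v i = twin_class G x \<and> x < n" if "i < k" "x \<in> v i" for i x
  proof -
    have "v i \<in> twin_class G ` {0..<n}"
      using v that G(2) by (auto simp: enumerates_def graph_skeleton_def dest: bij_betwE)
    then obtain a where a: "v i = twin_class G a" by blast
    then have "x < n" "twins G n a x" using that by (auto simp: twin_class_eq[OF G(2)])
    then show ?thesis
      unfolding a twin_class_eq[OF G(2)] by (simp add: twins_def)
  qed
  have vi: "v i = twin_class G x" "x < n" and vj: "v j = twin_class G y" "y < n"
    using is_class ij x y by auto
  have inj: "v i = v j \<longleftrightarrow> i = j"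
    using v ij by (auto simp: enumerates_def bij_betw_def inj_on_def)
  have swap: "adj_eq G a b \<longleftrightarrow> adj_eq G a' b'"
    \<comment> \<open>Twinness replaces the left endpoint only; symmetry of the graph brings the
      right one into that position.\<close>
    if "twins G n a a'" "twins G n b b'" "a < n" "a' < n" "b < n" "b' < n" for a b a' b'
  proof -
    have comm: "adj_eq G p q \<longleftrightarrow> adj_eq G q p" for p q using adj_eq_sym[OF G(1)] by blast
    have "adj_eq G a b \<longleftrightarrow> adj_eq G a' b" using that by (simp add: twins_def)
    also have "\<dots> \<longleftrightarrow> adj_eq G b a'" by (rule comm)
    also have "\<dots> \<longleftrightarrow> adj_eq G b' a'" using that by (simp add: twins_def)
    also have "\<dots> \<longleftrightarrow> adj_eq G a' b'" by (rule comm)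
    finally show ?thesis .
  qed
  have "(v i, v j) \<in> parcs (graph_skeleton G) \<longleftrightarrow> adj_eq G x y" if ne: "v i \<noteq> v j"
  proof
    assume "(v i, v j) \<in> parcs (graph_skeleton G)"
    then obtain a b where ab: "v i = twin_class G a" "v j = twin_class G b" "(a, b) \<in> parcs G"
      by (auto simp: graph_skeleton_def)
    then have abn: "a < n" "b < n" using in_arcsD1 in_arcsD2 G(2) by auto
    have "twins G n a x" "twins G n b y" using ab x y by (auto simp: twin_class_eq[OF G(2)])
    then show "adj_eq G x y" using swap[of a x b y] abn vi vj ab by (simp add: adj_eq_def)
  next
    assume "adj_eq G x y"
    then have "(x, y) \<in> parcs G" using ne vi vj by (auto simp: adj_eq_def)
    then show "(v i, v j) \<in> parcs (graph_skeleton G)"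
      using ne unfolding vi vj graph_skeleton_def by auto
  qed
  moreover have "adj_eq G x y" if "i = j"
  proof -
    have "twins G n x y" using that vi vj y by (auto simp: twin_class_eq[OF G(2)])
    then show ?thesis using vj by (auto simp: twins_def adj_eq_def)
  qed
  moreover have "adj_eq (relabel v k (graph_skeleton G)) i j \<longleftrightarrow>
      i = j \<or> (v i, v j) \<in> parcs (graph_skeleton G)"
    using ij by (simp add: adj_eq_def relabel_def)
  ultimately show ?thesis using inj by blast
qed

lemma adj_eq_skeleton_sym:
  assumes "pair_graph G" "adj_eq (relabel v k (graph_skeleton G)) i j"
  shows "adj_eq (relabel v k (graph_skeleton G)) j i"
proof -
  interpret pair_graph G by fact
  have "(D, C) \<in> parcs (graph_skeleton G)" if "(C, D) \<in> parcs (graph_skeleton G)" for C D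
    using that arcs_symmetric by (fastforce simp: graph_skeleton_def)
  then show ?thesis using assms(2) by (auto simp: adj_eq_def relabel_def)
qed

text \<open>Forming the skeleton involves a choice of decomposition. The second conjunct treats
  every choice and gives equality of the resulting spaces, not just unitary equivalence; the first
  provides a choice for each numbering of the classes, so the second is not vacuous.\<close>

theorem proposition3p14:
  fixes G :: "nat pair_pre_digraph" and n k :: nat
  assumes "pair_graph G"
    and "pverts G = {0..<n}"
    and "k = card (pverts (graph_skeleton G))"
  shows
    "(\<forall>v. enumerates v k (graph_skeleton G) \<longrightarrow>
        quantum_graph k (graph_system k (relabel v k (graph_skeleton G)), diagonal_algebra k) \<and>
        (\<exists>\<alpha> m U.
           blocks_indexed_by n (k, \<alpha>, m, U) v \<and>
           has_skeleton n (graph_system n G, diagonal_algebra n) (k, \<alpha>, m, U)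
             (k, graph_system k (relabel v k (graph_skeleton G)), diagonal_algebra k))) \<and>
     (\<forall>k' \<alpha> m U N R C.
        has_skeleton n (graph_system n G, diagonal_algebra n) (k', \<alpha>, m, U) (N, R, C) \<longrightarrow>
        k' = k \<and>
        (\<exists>v. enumerates v k (graph_skeleton G) \<and>
             blocks_indexed_by n (k, \<alpha>, m, U) v \<and>
             N = k \<and>
             R = graph_system k (relabel v k (graph_skeleton G)) \<and>
             C = diagonal_algebra k))"
proof -
  let ?S = "graph_system n G" and ?E = "twins G n"
  let ?H = "\<lambda>v. relabel v k (graph_skeleton G)"
  have S: "?S = pattern_space n (adj_eq G)"
    using assms(2) by (rule graph_system_eq_pattern_space)
  have H: "graph_system k (?H v) = pattern_space k (adj_eq (?H v))" for v
    by (rule graph_system_eq_pattern_space) (simp add: relabel_def)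
  have refl: "adj_eq G' x x" for G' :: "nat pair_pre_digraph" and x by (simp add: adj_eq_def)
  have quantum: "quantum_graph n (?S, diagonal_algebra n)"
    unfolding S by (rule quantum_graph_pattern_space) (rule refl, erule adj_eq_sym[OF assms(1)])
  have irreducible: "acts_irreducibly n ?S"
    unfolding S by (rule acts_irreducibly_pattern_space) (rule refl)
  have mult: "multiplier_algebra n ?S = pattern_space n ?E"
    unfolding S twins_def
    by (rule multiplier_algebra_pattern_space) (rule refl, erule adj_eq_sym[OF assms(1)])
  have verts: "pverts (graph_skeleton G) = (\<lambda>x. {y\<in>{0..<n}. ?E x y}) ` {0..<n}"
    using assms(2) by (simp add: graph_skeleton_def twin_class_eq)
  \<comment> \<open>Both conjuncts end here: it suffices to have a decomposition with multiplicities
    one whose summands are numbered by \<open>v\<close>.\<close>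
  have skeleton: "skeleton_wrt ?S (k, \<alpha>, m, U) = (k, graph_system k (?H v), diagonal_algebra k)"
    if v: "enumerates v k (graph_skeleton G)" and blocks: "blocks_indexed_by n (k, \<alpha>, m, U) v"
      and m: "\<And>i. i < k \<Longrightarrow> m i = Suc 0" and dec: "multiplier_decomposition n ?S (k, \<alpha>, m, U)"
    for v \<alpha> m U
    unfolding S H
  proof (rule skeleton_wrt_pattern_space)
    show "adj_eq G x y \<longleftrightarrow> adj_eq (?H v) i j" if "i < k" "j < k" "x \<in> v i" "y \<in> v j" for i j x y
      by (rule adj_eq_skeleton[OF assms(1,2) v that])
  qed (use blocks m dec in \<open>auto simp: blocks_indexed_by_iff multiplier_decomposition_iff\<close>)
  have "quantum_graph k (graph_system k (?H v), diagonal_algebra k) \<and>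
      (\<exists>\<alpha> m U. blocks_indexed_by n (k, \<alpha>, m, U) v \<and>
         has_skeleton n (?S, diagonal_algebra n) (k, \<alpha>, m, U)
           (k, graph_system k (?H v), diagonal_algebra k))"
    if v: "enumerates v k (graph_skeleton G)" for v
  proof
    show "quantum_graph k (graph_system k (?H v), diagonal_algebra k)"
      unfolding H
      by (rule quantum_graph_pattern_space) (rule refl, erule adj_eq_skeleton_sym[OF assms(1)])
    have bij: "bij_betw v {0..<k} ((\<lambda>x. {y\<in>{0..<n}. ?E x y}) ` {0..<n})"
      using v by (simp add: enumerates_def verts)
    \<comment> \<open>The sizes are forced: summand \<open>i\<close> is spanned by the basis vectors
      in the class \<open>v i\<close>, and its multiplicity is one.\<close>
    define \<alpha> where "\<alpha> i = card (v i)" for i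
    define m :: "nat \<Rightarrow> nat" where "m i = Suc 0" for i
    have d: "(\<lambda>i. \<alpha> i * m i) = (\<lambda>i. card (v i))" by (simp add: \<alpha>_def m_def)
    obtain U where U: "unitary_mat n U" and n: "block_start (\<lambda>i. \<alpha> i * m i) k = n"
      and pos: "\<And>i. i < k \<Longrightarrow> 0 < card (v i)"
      and conj: "conj_mat U ` pattern_space n ?E = pattern_space n (same_block (\<lambda>i. \<alpha> i * m i))"
      and proj: "\<And>i. i < k \<Longrightarrow>
        conj_mat (mat_adjoint U) (block_proj n (\<lambda>i. \<alpha> i * m i) i) = indicator_mat n (v i)"
      by (rule permutation_decomposition[OF bij, folded d])
        (rule twins_refl, erule twins_sym, erule (1) twins_trans, (rule that; simp))
    have blocks: "blocks_indexed_by n (k, \<alpha>, m, U) v"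
      using proj by (simp add: blocks_indexed_by_iff)
    moreover have dec: "multiplier_decomposition n ?S (k, \<alpha>, m, U)"
      unfolding multiplier_decomposition_iff mult
      using U pos n conj by (subst decomposition_multiplicity_one) (auto simp: \<alpha>_def m_def)
    ultimately show "\<exists>\<alpha> m U. blocks_indexed_by n (k, \<alpha>, m, U) v \<and>
         has_skeleton n (?S, diagonal_algebra n) (k, \<alpha>, m, U)
           (k, graph_system k (?H v), diagonal_algebra k)"
      using skeleton[OF v blocks _ dec] quantum irreducible
      by (intro exI[of _ \<alpha>] exI[of _ m] exI[of _ U]) (auto simp: has_skeleton_def m_def)
  qed
  moreover have "k' = k \<and> (\<exists>v. enumerates v k (graph_skeleton G) \<and> blocks_indexed_by n (k, \<alpha>, m, U) v \<and>
      N = k \<and> R = graph_system k (?H v) \<and> C = diagonal_algebra k)"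
    if skel: "has_skeleton n (?S, diagonal_algebra n) (k', \<alpha>, m, U) (N, R, C)" for k' \<alpha> m U N R C
  proof -
    let ?d = "\<lambda>i. \<alpha> i * m i"
    have dec: "multiplier_decomposition n ?S (k', \<alpha>, m, U)"
      and K: "(N, R, C) = skeleton_wrt ?S (k', \<alpha>, m, U)"
      using skel by (auto simp: has_skeleton_def)
    have pos: "\<And>i. i < k' \<Longrightarrow> 0 < \<alpha> i \<and> 0 < m i" and n: "block_start ?d k' = n"
      and U: "unitary_mat n U"
      and conj: "conj_mat U ` pattern_space n ?E =
        {diag_block_mat (map (\<lambda>i. kron (c i) (1\<^sub>m (m i))) [0..<k']) | c.
          \<forall>i<k'. c i \<in> carrier_mat (\<alpha> i) (\<alpha> i)}"
      using dec by (auto simp: multiplier_decomposition_iff mult)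
    \<comment> \<open>Multiplicities have to be settled before the projections, since only then is
      the decomposed algebra given by a relation on indices.\<close>
    have m: "m i = 1" if "i < k'" for i
      using multiplicity_one[OF twins_refl U pos n conj that] .
    have conj': "conj_mat U ` pattern_space n ?E = pattern_space n (same_block ?d)"
      unfolding conj using m n by (subst decomposition_multiplicity_one) simp_all
    obtain v where bij: "bij_betw v {0..<k'} ((\<lambda>x. {y\<in>{0..<n}. ?E x y}) ` {0..<n})"
      and proj: "\<And>i. i < k' \<Longrightarrow> conj_mat (mat_adjoint U) (block_proj n ?d i) = indicator_mat n (v i)"
      by (rule central_projections[OF _ _ _ U _ n conj'])
        (rule twins_refl, erule twins_sym, erule (1) twins_trans, simp add: pos, (rule that; simp))
    \<comment> \<open>Both numbers count the true-twin classes.\<close>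
    have k: "k' = k" using bij_betw_same_card[OF bij] assms(3) verts by simp
    have v: "enumerates v k (graph_skeleton G)" using bij k verts by (simp add: enumerates_def)
    moreover have blocks: "blocks_indexed_by n (k, \<alpha>, m, U) v"
      using proj k by (simp add: blocks_indexed_by_iff)
    moreover have "skeleton_wrt ?S (k, \<alpha>, m, U) = (k, graph_system k (?H v), diagonal_algebra k)"
      by (rule skeleton[OF v blocks]) (use m dec k in simp_all)
    ultimately show ?thesis using K k by auto
  qed
  ultimately show ?thesis by blast
qed

end
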